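(* Let $X$ be a real Banach space. For every integer $k\ge1$, $$e_k(X)\le 2\sup_{a\colon\ell^2_k\to\ell^2_k,\ \|a\|\le1}\|a\otimes\mathrm{Id}_X\|_{\ell^2_k(X)\to\ell^2_k(X)}.$$ In particular, $e_k(X)\le 2d_k(X)$ for every integer $k\ge1$.
   Context: $\ell^2$ and $\ell^2_k$ are the (real) infinite-dimensional separable and $k$-dimensional Hilbert sequence spaces, and $\ell^2(X)$, $\ell^2_k(X)$ are the corresponding spaces of square-summable $X$-valued sequences (of length $k$ in the second case). Set $e_k(X)=\sup\|u\otimes\mathrm{Id}_X\|_{B(\ell^2(X))}$, the supremum being over all linear maps $u\colon\ell^2\to\ell^2$ of norm $1$ and rank $k$. Set $d_k(X)=\sup\{d(E,\ell^2_{\dim E})\mid E\subset X\text{ a subspace},\ \dim E\le k\}$, where $d(E,F)=\inf\{\|u\|\|u^{-1}\|\mid u\colon E\to F\text{ an isomorphism}\}$ is the Banach-Mazur distance. *)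

theory Defs
  imports "HOL-Analysis.Analysis"
begin

section \<open>The spaces of square-summable sequences\<close>

typedef (overloaded) 'a l2 =
  "{x :: nat \<Rightarrow> 'a::real_normed_vector. summable (\<lambda>n. (norm (x n))\<^sup>2)}"
  morphisms l2_nth Abs_l2
  by (rule exI[of _ "\<lambda>_. 0"]) simp

setup_lifting type_definition_l2

lemma L2_set_le_sqrt_suminf:
  fixes x :: "nat \<Rightarrow> 'a::real_normed_vector"
  assumes "summable (\<lambda>n. (norm (x n))\<^sup>2)"
  shows "L2_set (\<lambda>n. norm (x n)) {..<N} \<le> sqrt (\<Sum>n. (norm (x n))\<^sup>2)"
  unfolding L2_set_def by (intro real_sqrt_le_mono sum_le_suminf assms) auto

lemma sqrt_suminf_le:
  fixes x :: "nat \<Rightarrow> 'a::real_normed_vector"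
  assumes "\<And>N. L2_set (\<lambda>n. norm (x n)) {..<N} \<le> C"
  shows "summable (\<lambda>n. (norm (x n))\<^sup>2)" "sqrt (\<Sum>n. (norm (x n))\<^sup>2) \<le> C"
proof -
  have C: "0 \<le> C" using assms[of 0] by simp
  have le: "(\<Sum>n<N. (norm (x n))\<^sup>2) \<le> C\<^sup>2" for N
    using sqrt_le_D[of "\<Sum>n<N. (norm (x n))\<^sup>2" C] assms[of N] unfolding L2_set_def by blast
  show summ: "summable (\<lambda>n. (norm (x n))\<^sup>2)"
    by (rule summableI_nonneg_bounded[of _ "C\<^sup>2"]) (use le in auto)
  show "sqrt (\<Sum>n. (norm (x n))\<^sup>2) \<le> C"
    using suminf_le_const[OF summ le] C by (simp add: real_le_lsqrt suminf_nonneg summ)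
qed

lemma L2_set_norm_add:
  fixes x y :: "nat \<Rightarrow> 'a::real_normed_vector"
  assumes "summable (\<lambda>n. (norm (x n))\<^sup>2)" "summable (\<lambda>n. (norm (y n))\<^sup>2)"
  shows "L2_set (\<lambda>n. norm (x n + y n)) {..<N}
           \<le> sqrt (\<Sum>n. (norm (x n))\<^sup>2) + sqrt (\<Sum>n. (norm (y n))\<^sup>2)"
proof -
  have "L2_set (\<lambda>n. norm (x n + y n)) {..<N} \<le> L2_set (\<lambda>n. norm (x n) + norm (y n)) {..<N}"
    by (rule L2_set_mono) (auto simp: norm_triangle_ineq)
  also have "\<dots> \<le> L2_set (\<lambda>n. norm (x n)) {..<N} + L2_set (\<lambda>n. norm (y n)) {..<N}"
    by (rule L2_set_triangle_ineq)
  also have "\<dots> \<le> sqrt (\<Sum>n. (norm (x n))\<^sup>2) + sqrt (\<Sum>n. (norm (y n))\<^sup>2)"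
    using L2_set_le_sqrt_suminf assms by (intro add_mono) auto
  finally show ?thesis .
qed

instantiation l2 :: (real_normed_vector) real_normed_vector
begin

lift_definition zero_l2 :: "'a l2" is "\<lambda>_. 0"
  by simp

lift_definition plus_l2 :: "'a l2 \<Rightarrow> 'a l2 \<Rightarrow> 'a l2" is "\<lambda>x y n. x n + y n"
  by (rule sqrt_suminf_le(1)[OF L2_set_norm_add])

lift_definition uminus_l2 :: "'a l2 \<Rightarrow> 'a l2" is "\<lambda>x n. - x n"
  by simp

lift_definition minus_l2 :: "'a l2 \<Rightarrow> 'a l2 \<Rightarrow> 'a l2" is "\<lambda>x y n. x n - y n"
proof -
  fix x y :: "nat \<Rightarrow> 'a"
  assume x: "summable (\<lambda>n. (norm (x n))\<^sup>2)" and y: "summable (\<lambda>n. (norm (y n))\<^sup>2)"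
  from y have "summable (\<lambda>n. (norm (- y n))\<^sup>2)" by simp
  from sqrt_suminf_le(1)[OF L2_set_norm_add[OF x this]]
  show "summable (\<lambda>n. (norm (x n - y n))\<^sup>2)" by simp
qed

lift_definition scaleR_l2 :: "real \<Rightarrow> 'a l2 \<Rightarrow> 'a l2" is "\<lambda>c x n. c *\<^sub>R x n"
  by (simp add: power_mult_distrib summable_mult)

lift_definition norm_l2 :: "'a l2 \<Rightarrow> real" is "\<lambda>x. sqrt (\<Sum>n. (norm (x n))\<^sup>2)" .

definition dist_l2 :: "'a l2 \<Rightarrow> 'a l2 \<Rightarrow> real"
  where "dist_l2 x y = norm (x - y)"

definition sgn_l2 :: "'a l2 \<Rightarrow> 'a l2"
  where "sgn_l2 x = inverse (norm x) *\<^sub>R x"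

definition uniformity_l2 :: "('a l2 \<times> 'a l2) filter"
  where "uniformity_l2 = (INF e\<in>{0<..}. principal {(x, y). dist x y < e})"

definition open_l2 :: "'a l2 set \<Rightarrow> bool"
  where "open_l2 S = (\<forall>x\<in>S. \<forall>\<^sub>F (x', y) in uniformity. x' = x \<longrightarrow> y \<in> S)"

instance
proof
  fix x y z :: "'a l2" and a b :: real
  show "x + y + z = x + (y + z)" "x + y = y + x" "0 + x = x" "- x + x = 0" "x - y = x + - y"
    by (transfer; simp add: algebra_simps; fail)+
  show "a *\<^sub>R (x + y) = a *\<^sub>R x + a *\<^sub>R y" "(a + b) *\<^sub>R x = a *\<^sub>R x + b *\<^sub>R x"
       "a *\<^sub>R b *\<^sub>R x = (a * b) *\<^sub>R x" "1 *\<^sub>R x = x"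
    by (transfer; simp add: scaleR_add_right scaleR_add_left; fail)+
  show "norm x = 0 \<longleftrightarrow> x = 0"
    by transfer (auto simp: suminf_eq_zero_iff fun_eq_iff)
  show "norm (x + y) \<le> norm x + norm y"
    by transfer (rule sqrt_suminf_le(2)[OF L2_set_norm_add])
  show "norm (a *\<^sub>R x) = \<bar>a\<bar> * norm x"
    by transfer (simp add: power_mult_distrib suminf_mult real_sqrt_mult)
qed (simp_all only: dist_l2_def sgn_l2_def uniformity_l2_def open_l2_def)

end

text \<open>
  \<open>l2_fin k\<close> is the space of sequences of length \<open>k\<close>, embedded isometrically in the
  infinite sequences by extending with zeros.
\<close>

definition l2_fin :: "nat \<Rightarrow> 'a::real_normed_vector l2 set"
  where "l2_fin k = {x. \<forall>n\<ge>k. l2_nth x n = 0}"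

lift_definition l2_unit :: "nat \<Rightarrow> real l2" is "\<lambda>m n. if n = m then 1 else 0"
  by (rule summable_finite[of "{m}" for m]) auto


section \<open>Linear maps between subspaces and their norms\<close>

definition linear_between ::
    "'a::real_vector set \<Rightarrow> 'b::real_vector set \<Rightarrow> ('a \<Rightarrow> 'b) \<Rightarrow> bool"
  where "linear_between S T f \<longleftrightarrow>
    f ` S \<subseteq> T \<and>
    (\<forall>x\<in>S. \<forall>y\<in>S. f (x + y) = f x + f y) \<and>
    (\<forall>c. \<forall>x\<in>S. f (c *\<^sub>R x) = c *\<^sub>R f x)"

text \<open>
  The relative version of \<^const>\<open>onorm\<close>; being \<^typ>\<open>ennreal\<close>-valued, it is infinite
  exactly for unbounded maps.
\<close>

definition onorm_on :: "'a::real_normed_vector set \<Rightarrow> ('a \<Rightarrow> 'b::real_normed_vector) \<Rightarrow> ennreal"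
  where "onorm_on S f = (SUP x\<in>S. ennreal (norm (f x) / norm x))"

lemma onorm_on_UNIV:
  assumes "bounded_linear f"
  shows "onorm_on UNIV f = ennreal (onorm f)"
proof (rule antisym)
  show "onorm_on UNIV f \<le> ennreal (onorm f)"
    unfolding onorm_on_def by (intro SUP_least ennreal_leI le_onorm assms)
next
  show "ennreal (onorm f) \<le> onorm_on UNIV f"
  proof (cases "onorm_on UNIV f")
    case (real r)
    have "norm (f x) / norm x \<le> r" for x
    proof -
      have "ennreal (norm (f x) / norm x) \<le> onorm_on UNIV f"
        unfolding onorm_on_def by (rule SUP_upper) simp
      with real show ?thesis by simp
    qed
    then have "onorm f \<le> r"
      unfolding onorm_def by (intro cSUP_least) auto
    with real show ?thesis by (simp add: ennreal_leI)
  qed simp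
qed

definition finite_dim :: "'a::real_vector set \<Rightarrow> bool"
  where "finite_dim V \<longleftrightarrow> (\<exists>B. finite B \<and> V \<subseteq> span B)"


section \<open>Amplification to vector-valued sequences\<close>

text \<open>
  The operator \<open>u \<otimes> Id\<^sub>X\<close>, where \<open>u\<close> acts through its matrix \<open>(u\<^sub>m\<^sub>n)\<close>,
  \<open>u\<^sub>m\<^sub>n = (u e\<^sub>n)\<^sub>m\<close>. The value is only meaningful when the resulting sequence is again
  square-summable; this holds for all \<open>x\<close> if \<open>u\<close> is bounded of finite rank. As \<open>x\<close>
  vanishes from \<open>k\<close> on when it lies in \<open>l2_fin k\<close>, the same formula amplifies a linear map
  \<open>l2_fin k \<rightarrow> l2_fin k\<close> without regard to its values outside \<open>l2_fin k\<close>.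
\<close>

definition tensor_Id :: "(real l2 \<Rightarrow> real l2) \<Rightarrow> 'a::banach l2 \<Rightarrow> 'a l2"
  where "tensor_Id u x = Abs_l2 (\<lambda>m. \<Sum>n. l2_nth (u (l2_unit n)) m *\<^sub>R l2_nth x n)"

lift_definition elem_tensor :: "real l2 \<Rightarrow> 'a::real_normed_vector \<Rightarrow> 'a l2"
  is "\<lambda>\<xi> x n. \<xi> n *\<^sub>R x"
  by (simp add: power_mult_distrib summable_mult2)

lemma norm_l2_nth_le: "norm (l2_nth x n) \<le> norm x"
proof (transfer fixing: n)
  fix x :: "nat \<Rightarrow> 'a"
  assume s: "summable (\<lambda>n. (norm (x n))\<^sup>2)"
  have "norm (x n) \<le> L2_set (\<lambda>n. norm (x n)) {..<Suc n}"
    by (rule member_le_L2_set) auto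
  also have "\<dots> \<le> sqrt (\<Sum>n. (norm (x n))\<^sup>2)"
    by (rule L2_set_le_sqrt_suminf[OF s])
  finally show "norm (x n) \<le> sqrt (\<Sum>n. (norm (x n))\<^sup>2)" .
qed

lemma bounded_linear_l2_nth: "bounded_linear (\<lambda>x. l2_nth x n)"
  by (rule bounded_linear_intro[of _ 1])
     (simp_all add: plus_l2.rep_eq scaleR_l2.rep_eq norm_l2_nth_le)

lemma l2_nth_sum: "l2_nth (sum f A) n = (\<Sum>i\<in>A. l2_nth (f i) n)"
  using linear_sum[OF bounded_linear.linear[OF bounded_linear_l2_nth[of n]], of f A] by simp

lemma l2_unit_sums:
  fixes \<xi> :: "real l2"
  shows "(\<lambda>n. l2_nth \<xi> n *\<^sub>R l2_unit n) sums \<xi>"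
proof -
  define tail where "tail N = (\<Sum>n. (norm (l2_nth \<xi> (n + N)))\<^sup>2)" for N
  have s: "summable (\<lambda>n. (norm (l2_nth \<xi> n))\<^sup>2)"
    using l2_nth[of \<xi>] by simp
  have "norm ((\<Sum>n<N. l2_nth \<xi> n *\<^sub>R l2_unit n) - \<xi>) = sqrt (tail N)" for N
  proof -
    have nth: "l2_nth ((\<Sum>n<N. l2_nth \<xi> n *\<^sub>R l2_unit n) - \<xi>) m
                 = (if m < N then 0 else - l2_nth \<xi> m)" for m
      by (simp add: minus_l2.rep_eq l2_nth_sum scaleR_l2.rep_eq l2_unit.rep_eq if_distrib
          sum.delta cong: if_cong)
    define g where "g = (\<lambda>m. (norm (if m < N then 0 else - l2_nth \<xi> m))\<^sup>2)"
    have sg: "summable g"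
      by (rule summable_comparison_test'[OF s, of 0]) (auto simp: g_def)
    have "(\<Sum>m. g m) = (\<Sum>m. g (m + N)) + (\<Sum>m<N. g m)"
      by (rule suminf_split_initial_segment[OF sg])
    then have "(\<Sum>m. g m) = tail N" by (simp add: g_def tail_def)
    then show ?thesis by (simp add: norm_l2.rep_eq nth g_def)
  qed
  moreover have "(\<lambda>N. sqrt (tail N)) \<longlonglongrightarrow> sqrt 0"
    unfolding tail_def by (intro tendsto_real_sqrt suminf_exist_split2 s)
  ultimately show ?thesis
    unfolding sums_def by (subst LIM_zero_iff[symmetric], subst tendsto_norm_zero_iff[symmetric]) simp
qed

lemma tensor_Id_elem_tensor:
  assumes u: "bounded_linear u"
  shows "tensor_Id u (elem_tensor \<xi> x) = elem_tensor (u \<xi>) x"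
proof -
  have "(\<Sum>n. l2_nth (u (l2_unit n)) m *\<^sub>R l2_nth (elem_tensor \<xi> x) n) = l2_nth (elem_tensor (u \<xi>) x) m"
    for m
  proof -
    have bl: "bounded_linear (\<lambda>\<xi>. l2_nth (u \<xi>) m *\<^sub>R x)"
      by (intro bounded_linear_scaleR_const bounded_linear_compose[OF bounded_linear_l2_nth u])
    have "(\<lambda>n. l2_nth (u (l2_nth \<xi> n *\<^sub>R l2_unit n)) m *\<^sub>R x) sums (l2_nth (u \<xi>) m *\<^sub>R x)"
      by (rule bounded_linear.sums[OF bl l2_unit_sums])
    then show ?thesis
      by (simp add: elem_tensor.rep_eq linear_cmul[OF bounded_linear.linear[OF u]] scaleR_l2.rep_eq
          sums_iff mult.commute)
  qed
  then show ?thesis by (simp add: tensor_Id_def l2_nth_inverse)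
qed


section \<open>The constants \<open>e\<^sub>k(X)\<close> and \<open>d\<^sub>k(X)\<close>\<close>

definition e_const :: "'a::banach itself \<Rightarrow> nat \<Rightarrow> ennreal"
  where "e_const X k =
    (SUP u\<in>{u. bounded_linear u \<and> onorm u = 1 \<and> finite_dim (range u) \<and> dim (range u) = k}.
       onorm_on UNIV (tensor_Id u :: 'a l2 \<Rightarrow> 'a l2))"

definition banach_mazur_dist ::
    "'a::real_normed_vector set \<Rightarrow> 'b::real_normed_vector set \<Rightarrow> ennreal"
  where "banach_mazur_dist E F =
    (INF u\<in>{u. linear_between E F u \<and> bij_betw u E F}. onorm_on E u * onorm_on F (inv_into E u))"

definition d_const :: "'a::banach itself \<Rightarrow> nat \<Rightarrow> ennreal"
  where "d_const X k =
    (SUP E\<in>{E :: 'a set. subspace E \<and> finite_dim E \<and> dim E \<le> k}.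
       banach_mazur_dist E (l2_fin (dim E) :: real l2 set))"

end

theory Submission
  imports Defs
begin

text \<open>
  Let \<open>C\<close> be the supremum of the norms of \<open>a \<otimes> Id\<^sub>X\<close> over contractions \<open>a\<close> of \<open>\<ell>\<^sup>2\<^sub>k\<close>, and let
  \<open>u\<close> be a contraction of \<open>\<ell>\<^sup>2\<close> of rank at most \<open>k\<close>. By approximation, \<open>u\<close> may be taken to be a finite
  matrix. For a finite sequence \<open>x\<close> in \<open>X\<close>, the sequence \<open>y = (u \<otimes> Id) x\<close> may have many entries, but
  \<open>y\<^sub>i = T f\<^sub>i\<close>, where \<open>T v = \<Sum> v\<^sub>i y\<^sub>i\<close> and \<open>f\<^sub>i\<close> is the projection of the \<open>i\<close>-th coordinate vector
  onto the range of \<open>u\<close>. The main point is that the many vectors \<open>f\<^sub>i\<close> can be replaced by an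
  orthonormal basis \<open>(z\<^sub>l)\<close> of the range, which has at most \<open>k\<close> members, with
  \<open>\<Sum> \<parallel>T f\<^sub>i\<parallel>\<^sup>2 \<le> 2 \<Sum> \<parallel>T z\<^sub>l\<parallel>\<^sup>2\<close> (\<^emph>\<open>orthonormal_selection\<close> and \<^emph>\<open>few_coordinates_suffice\<close>).
  The basis is found greedily, as in the proof of the Dvoretzky-Rogers lemma: an averaging argument over
  the normalised projections of the coordinate vectors shows that some choice gains at least what it
  costs. Norming functionals of the \<open>y\<^sub>i\<close>, hence the Hahn-Banach theorem, serve to bound \<open>\<parallel>T z\<parallel>\<close>
  from below.

  This reduces the range of \<open>u\<close> to \<open>k\<close> coordinates at the cost of a factor \<open>\<surd>2\<close>. The same
  selection, applied to the adjoint and the dual space \<open>X\<^sup>*\<close>, reduces the domain to \<open>k\<close> coordinates,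
  again at the cost of \<open>\<surd>2\<close> (\<^emph>\<open>rank_amplification_le\<close>). What is left is a \<open>k \<times> k\<close> contraction,
  so the norm of \<open>u \<otimes> Id\<^sub>X\<close> is at most \<open>2 C\<close>.

  The second inequality follows from \<open>C \<le> d\<^sub>k(X)\<close>: a sequence of length \<open>k\<close> spans a subspace \<open>E\<close> of
  dimension at most \<open>k\<close>, and an isomorphism of \<open>E\<close> onto a Hilbert space carries the action of \<open>a\<close> on
  \<open>E\<close>-valued sequences to its action on Hilbert-space-valued ones, which is contractive.
\<close>

section \<open>Norming functionals\<close>

definition sublinear :: "('a::real_vector \<Rightarrow> real) \<Rightarrow> bool"
  where "sublinear p \<longleftrightarrow>
    (\<forall>x y. p (x + y) \<le> p x + p y) \<and> (\<forall>c\<ge>0. \<forall>x. p (c *\<^sub>R x) = c * p x)"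

lemma sublinearD:
  assumes "sublinear p"
  shows "p (x + y) \<le> p x + p y" "0 \<le> c \<Longrightarrow> p (c *\<^sub>R x) = c * p x" "p 0 = 0" "- p (- x) \<le> p x"
proof -
  show add: "p (x + y) \<le> p x + p y" for x y using assms by (simp add: sublinear_def)
  show scale: "0 \<le> c \<Longrightarrow> p (c *\<^sub>R x) = c * p x" for c x using assms by (simp add: sublinear_def)
  from scale[of 0 0] show 0: "p 0 = 0" by simp
  from add[of x "- x"] 0 show "- p (- x) \<le> p x" by simp
qed

text \<open>
  A linear functional is a sublinear functional that has no other sublinear functional below it.
  The lemma produces, below any sublinear \<open>p\<close>, one that satisfies the inequality
  \<open>q (x) + p (a) \<le> p (x + a)\<close>, the missing half of additivity. The witness is the infimum of
  \<open>p (x + t a) - t p (a)\<close> over \<open>t \<ge> 0\<close>: it lies below \<open>p\<close> by \<open>t = 0\<close> and satisfies the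
  inequality by \<open>t = 1\<close>.
\<close>

lemma sublinear_descent:
  assumes p: "sublinear p"
  obtains q where "sublinear q" "q \<le> p" "\<And>x. q x \<le> p (x + a) - p a"
proof -
  note pD = sublinearD[OF p]
  define F where "F x t = p (x + t *\<^sub>R a) - t * p a" for x t
  define q where "q x = (INF t\<in>{0..}. F x t)" for x
  have lower: "- p (- x) \<le> F x t" if "0 \<le> t" for x t
    using pD(1)[of "x + t *\<^sub>R a" "- x"] that by (simp add: F_def pD)
  have bdd: "bdd_below (F x ` {0..})" for x
    by (rule bdd_belowI2[where m = "- p (- x)"]) (simp add: lower)
  have le: "q x \<le> F x t" if "0 \<le> t" for x t
    unfolding q_def by (rule cINF_lower[OF bdd]) (use that in simp)
  have ge: "c \<le> q x" if "\<And>t. 0 \<le> t \<Longrightarrow> c \<le> F x t" for c x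
    unfolding q_def by (rule cINF_greatest) (use that in auto)
  have add: "q (x + y) \<le> q x + q y" for x y
  proof -
    have "q (x + y) - F x s \<le> F y t" if "0 \<le> s" "0 \<le> t" for s t
    proof -
      have "q (x + y) \<le> F (x + y) (s + t)" using that by (intro le) simp
      also have "\<dots> \<le> F x s + F y t"
        using pD(1)[of "x + s *\<^sub>R a" "y + t *\<^sub>R a"] by (simp add: F_def algebra_simps)
      finally show ?thesis by simp
    qed
    then have "q (x + y) - F x s \<le> q y" if "0 \<le> s" for s
      using that by (intro ge) auto
    then have "q (x + y) - q y \<le> q x"
      by (intro ge) (simp add: algebra_simps)
    then show ?thesis by simp
  qed
  have scale_le: "q (c *\<^sub>R x) \<le> c * q x" if "0 < c" for c x
  proof -
    have "q (c *\<^sub>R x) / c \<le> F x t" if "0 \<le> t" for t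
    proof -
      have "q (c *\<^sub>R x) \<le> F (c *\<^sub>R x) (c * t)" using that \<open>0 < c\<close> by (intro le) simp
      also have "\<dots> = c * F x t"
        using \<open>0 < c\<close> pD(2)[of c "x + t *\<^sub>R a"] by (simp add: F_def algebra_simps)
      finally show ?thesis using \<open>0 < c\<close> by (simp add: field_simps)
    qed
    from ge[OF this] show ?thesis using that by (simp add: field_simps)
  qed
  have scale: "q (c *\<^sub>R x) = c * q x" if "0 \<le> c" for c x
  proof (cases "c = 0")
    case True
    have "q 0 \<le> 0" using le[of 0 0] by (simp add: F_def pD)
    moreover have "0 \<le> q 0" by (rule ge) (use lower[of _ 0] in \<open>simp add: pD\<close>)
    ultimately show ?thesis using True by simp
  next
    case False
    with that have "0 < c" by simp
    have "c * q x = c * q (inverse c *\<^sub>R (c *\<^sub>R x))" using \<open>0 < c\<close> by simp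
    also have "\<dots> \<le> c * (inverse c * q (c *\<^sub>R x))"
      using \<open>0 < c\<close> by (intro mult_left_mono scale_le) auto
    also have "\<dots> = q (c *\<^sub>R x)" using \<open>0 < c\<close> by simp
    finally show ?thesis using scale_le[OF \<open>0 < c\<close>, of x] by simp
  qed
  show ?thesis
  proof
    show "sublinear q" using add scale by (simp add: sublinear_def)
    show "q \<le> p" using le[of 0] by (auto simp: le_fun_def F_def)
    show "q x \<le> p (x + a) - p a" for x using le[of 1 x] by (simp add: F_def)
  qed
qed

text \<open>
  The Hahn-Banach theorem in sublinear form. Chains of sublinear functionals below \<open>p\<close> have their
  pointwise infimum as a lower bound, so Zorn's lemma gives a minimal one, which is additive by
  \<^emph>\<open>sublinear_descent\<close>.
\<close>

lemma linear_below_sublinear: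
  assumes p: "sublinear p"
  obtains f where "linear f" "f \<le> p"
proof -
  define A where "A = {q. sublinear q \<and> q \<le> p}"
  have "\<exists>m\<in>A. \<forall>q\<in>A. q \<le> m \<longrightarrow> q = m"
  proof (rule predicate_Zorn[where P = "\<lambda>q q'. q' \<le> q"])
    show "partial_order_on A (relation_of (\<lambda>q q'. q' \<le> q) A)"
      by (rule partial_order_on_relation_ofI) auto
  next
    fix C assume C: "C \<in> Chains (relation_of (\<lambda>q q'. q' \<le> q) A)"
    have CA: "C \<subseteq> A" by (rule Chains_relation_of[OF C])
    have chain: "q \<le> q' \<or> q' \<le> q" if "q \<in> C" "q' \<in> C" for q q'
      using C that by (auto simp: Chains_def relation_of_def)
    show "\<exists>u\<in>A. \<forall>q\<in>C. u \<le> q"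
    proof (cases "C = {}")
      case True
      with p show ?thesis by (auto simp: A_def)
    next
      case False
      define u where "u x = (INF q\<in>C. q x)" for x
      have sub: "sublinear q" and qp: "q x \<le> p x" if "q \<in> C" for q x
        using CA that by (auto simp: A_def le_fun_def)
      (* Every member of the chain is at least - p (- x) at x, so the infimum is finite. *)
      have bdd: "bdd_below ((\<lambda>q. q x) ` C)" for x
      proof (rule bdd_belowI2[where m = "- p (- x)"])
        fix q assume "q \<in> C"
        from qp[OF this, of "- x"] sublinearD(4)[OF sub[OF this], of x]
        show "- p (- x) \<le> q x" by simp
      qed
      have le: "u x \<le> q x" if "q \<in> C" for q x
        unfolding u_def by (rule cINF_lower[OF bdd that])
      have ge: "c \<le> u x" if "\<And>q. q \<in> C \<Longrightarrow> c \<le> q x" for c x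
        unfolding u_def by (rule cINF_greatest[OF False that])
      have add: "u (x + y) \<le> u x + u y" for x y
      proof -
        have "u (x + y) - q x \<le> q' y" if qq: "q \<in> C" "q' \<in> C" for q q'
        proof -
          obtain r where r: "r \<in> C" "r \<le> q" "r \<le> q'"
            using chain[OF qq] qq by (metis order_refl)
          have "u (x + y) \<le> r x + r y"
            using le[OF r(1)] sublinearD(1)[OF sub[OF r(1)]] order_trans by blast
          also have "\<dots> \<le> q x + q' y" using r by (intro add_mono) (auto simp: le_fun_def)
          finally show ?thesis by simp
        qed
        then have "u (x + y) - q x \<le> u y" if "q \<in> C" for q using that by (intro ge) auto
        then have "u (x + y) - u y \<le> u x" by (intro ge) (simp add: algebra_simps)
        then show ?thesis by simp
      qed
      have scale: "u (c *\<^sub>R x) = c * u x" if "0 \<le> c" for c x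
      proof (cases "c = 0")
        case True
        have "u 0 = (INF q\<in>C. 0)" unfolding u_def
          by (rule INF_cong) (auto simp: sublinearD(3)[OF sub])
        then show ?thesis using True False by simp
      next
        case pos: False
        with that have "0 < c" by simp
        have "u (c *\<^sub>R x) / c \<le> u x"
          by (rule ge) (use le[of _ "c *\<^sub>R x"] \<open>0 < c\<close> sublinearD(2)[OF sub that, of _ x] in
            \<open>simp add: field_simps\<close>)
        moreover have "c * u x \<le> u (c *\<^sub>R x)"
        proof (rule ge)
          fix q assume "q \<in> C"
          from le[OF this, of x] \<open>0 < c\<close> sublinearD(2)[OF sub[OF this] that, of x]
          show "c * u x \<le> q (c *\<^sub>R x)" by simp
        qed
        ultimately show ?thesis using \<open>0 < c\<close> by (simp add: field_simps)
      qed
      have "u \<le> p" using False le qp unfolding le_fun_def by (meson ex_in_conv order_trans)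
      then have "u \<in> A" using add scale by (simp add: A_def sublinear_def)
      then show ?thesis using le by (auto simp: le_fun_def)
    qed
  qed
  then obtain m where m: "sublinear m" "m \<le> p"
    and minimal: "\<And>q. sublinear q \<Longrightarrow> q \<le> m \<Longrightarrow> q = m"
    unfolding A_def by (auto intro: order_trans)
  note mD = sublinearD[OF m(1)]
  have add: "m (x + a) = m x + m a" for x a
  proof -
    obtain q where q: "sublinear q" "q \<le> m" "\<And>x. q x \<le> m (x + a) - m a"
      using sublinear_descent[OF m(1)] by blast
    from minimal[OF q(1,2)] q(3)[of x] mD(1)[of x a] show ?thesis by simp
  qed
  have neg: "m (- x) = - m x" for x using add[of x "- x"] mD(3) by simp
  have "m (c *\<^sub>R x) = c * m x" for c x
    using mD(2)[of c x] mD(2)[of "- c" x] neg[of "c *\<^sub>R x"] by (cases "0 \<le> c") auto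
  with add have "linear m" by (intro linearI) auto
  then show ?thesis using m(2) that by blast
qed

text \<open>
  A norming functional of \<open>x\<close>, scaled by \<open>\<parallel>x\<parallel>\<close>. The descent is applied to the norm in the direction
  \<open>x\<close> first: a linear functional \<open>f\<close> below the result has \<open>f (- x) \<le> - \<parallel>x\<parallel>\<close>, so that
  \<open>f (x)\<close> is forced to be \<open>\<parallel>x\<parallel>\<close>.
\<close>

lemma duality_map:
  fixes x :: "'a::real_normed_vector"
  obtains \<phi> :: "'a \<Rightarrow>\<^sub>L real" where "norm \<phi> \<le> norm x" "\<phi> x = (norm x)\<^sup>2"
proof -
  have "sublinear (norm :: 'a \<Rightarrow> real)" by (simp add: sublinear_def norm_triangle_ineq)
  then obtain q :: "'a \<Rightarrow> real"
    where q: "sublinear q" "q \<le> norm" "\<And>v. q v \<le> norm (v + x) - norm x"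
    by (rule sublinear_descent[where a = x]) blast
  obtain f where f: "linear f" "f \<le> q" by (rule linear_below_sublinear[OF q(1)])
  have f_le: "f v \<le> norm v" for v using f(2) q(2) by (auto simp: le_fun_def intro: order_trans)
  have bound: "\<bar>f v\<bar> \<le> norm v" for v
    using f_le[of v] f_le[of "- v"] linear_neg[OF f(1), of v] by simp
  have "f (- x) \<le> q (- x)" using f(2) by (simp add: le_fun_def)
  with q(3)[of "- x"] have "norm x \<le> f x" by (simp add: linear_neg[OF f(1)])
  with f_le[of x] have fx: "f x = norm x" by simp
  have "bounded_linear f"
    using bound linear_add[OF f(1)] linear_cmul[OF f(1)]
    by (intro bounded_linear_intro[where K = 1]) auto
  then have app: "blinfun_apply (Blinfun f) = f" by (rule bounded_linear_Blinfun_apply)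
  have "norm (Blinfun f) \<le> 1" by (rule norm_blinfun_bound) (use bound app in auto)
  then have "norm (norm x *\<^sub>R Blinfun f) \<le> norm x" by (simp add: mult_left_le)
  moreover have "(norm x *\<^sub>R Blinfun f) x = (norm x)\<^sup>2"
    by (simp add: scaleR_blinfun.rep_eq app fx power2_eq_square)
  ultimately show ?thesis by (rule that)
qed


section \<open>Contractions and projections as finite matrices\<close>

definition contraction_mat :: "'i set \<Rightarrow> 'j set \<Rightarrow> ('i \<Rightarrow> 'j \<Rightarrow> real) \<Rightarrow> bool"
  where "contraction_mat I J A \<longleftrightarrow>
    (\<forall>v. (\<Sum>i\<in>I. (\<Sum>j\<in>J. A i j * v j)\<^sup>2) \<le> (\<Sum>j\<in>J. (v j)\<^sup>2))"

lemma contraction_matD: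
  "contraction_mat I J A \<Longrightarrow> (\<Sum>i\<in>I. (\<Sum>j\<in>J. A i j * v j)\<^sup>2) \<le> (\<Sum>j\<in>J. (v j)\<^sup>2)"
  by (simp add: contraction_mat_def)

lemma contraction_mat_transpose:
  assumes A: "contraction_mat I J A"
  shows "contraction_mat J I (\<lambda>j i. A i j)"
  unfolding contraction_mat_def
proof
  fix w :: "'a \<Rightarrow> real"
  define v where "v j = (\<Sum>i\<in>I. A i j * w i)" for j
  define V where "V = (\<Sum>j\<in>J. (v j)\<^sup>2)"
  have "V = (\<Sum>j\<in>J. \<Sum>i\<in>I. w i * (A i j * v j))"
    unfolding V_def by (simp add: power2_eq_square, simp add: v_def sum_distrib_left mult_ac)
  also have "\<dots> = (\<Sum>i\<in>I. w i * (\<Sum>j\<in>J. A i j * v j))"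
    by (subst sum.swap) (simp add: sum_distrib_left)
  finally have "V\<^sup>2 \<le> (\<Sum>i\<in>I. (w i)\<^sup>2) * (\<Sum>i\<in>I. (\<Sum>j\<in>J. A i j * v j)\<^sup>2)"
    by (simp add: Cauchy_Schwarz_ineq_sum)
  also have "\<dots> \<le> (\<Sum>i\<in>I. (w i)\<^sup>2) * V"
    unfolding V_def by (intro mult_left_mono contraction_matD A sum_nonneg) auto
  finally have "V * V \<le> (\<Sum>i\<in>I. (w i)\<^sup>2) * V" by (simp add: power2_eq_square)
  moreover have "0 \<le> V" "0 \<le> (\<Sum>i\<in>I. (w i)\<^sup>2)" by (auto simp: V_def intro: sum_nonneg)
  ultimately have "V \<le> (\<Sum>i\<in>I. (w i)\<^sup>2)"
    by (cases "V = 0") (auto simp: mult_le_cancel_right)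
  then show "(\<Sum>j\<in>J. (\<Sum>i\<in>I. A i j * w i)\<^sup>2) \<le> (\<Sum>i\<in>I. (w i)\<^sup>2)"
    by (simp add: V_def v_def)
qed

lemma contraction_mat_mult:
  assumes "contraction_mat H I A" "contraction_mat I J B"
  shows "contraction_mat H J (\<lambda>h j. \<Sum>i\<in>I. A h i * B i j)"
  unfolding contraction_mat_def
proof
  fix v :: "'c \<Rightarrow> real"
  have "(\<Sum>j\<in>J. (\<Sum>i\<in>I. A h i * B i j) * v j) = (\<Sum>i\<in>I. A h i * (\<Sum>j\<in>J. B i j * v j))" for h
    unfolding sum_distrib_left sum_distrib_right by (subst sum.swap) (simp add: mult_ac)
  then have "(\<Sum>h\<in>H. (\<Sum>j\<in>J. (\<Sum>i\<in>I. A h i * B i j) * v j)\<^sup>2) \<le> (\<Sum>i\<in>I. (\<Sum>j\<in>J. B i j * v j)\<^sup>2)"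
    using contraction_matD[OF assms(1), of "\<lambda>i. \<Sum>j\<in>J. B i j * v j"] by simp
  also have "\<dots> \<le> (\<Sum>j\<in>J. (v j)\<^sup>2)" by (rule contraction_matD[OF assms(2)])
  finally show "(\<Sum>h\<in>H. (\<Sum>j\<in>J. (\<Sum>i\<in>I. A h i * B i j) * v j)\<^sup>2) \<le> (\<Sum>j\<in>J. (v j)\<^sup>2)" .
qed

text \<open>
  The transpose of \<open>z\<close> is an isometry, in particular a contraction.
\<close>

lemma contraction_mat_orthonormal_rows:
  assumes "finite L"
    and orth: "\<And>l l'. l \<in> L \<Longrightarrow> l' \<in> L \<Longrightarrow> (\<Sum>i\<in>I. z l i * z l' i) = (if l = l' then 1 else 0)"
  shows "contraction_mat L I z"
proof -
  have "contraction_mat I L (\<lambda>i l. z l i)"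
    unfolding contraction_mat_def
  proof
    fix v :: "'a \<Rightarrow> real"
    have "(\<Sum>i\<in>I. (\<Sum>l\<in>L. z l i * v l)\<^sup>2)
        = (\<Sum>i\<in>I. \<Sum>l\<in>L. \<Sum>l'\<in>L. (z l i * v l) * (z l' i * v l'))"
      by (simp add: power2_eq_square sum_product)
    also have "\<dots> = (\<Sum>l\<in>L. \<Sum>l'\<in>L. \<Sum>i\<in>I. (z l i * v l) * (z l' i * v l'))"
      by (subst sum.swap, rule sum.cong[OF refl], subst sum.swap) simp
    also have "\<dots> = (\<Sum>l\<in>L. \<Sum>l'\<in>L. v l * v l' * (\<Sum>i\<in>I. z l i * z l' i))"
      by (simp add: sum_distrib_left mult_ac)
    also have "\<dots> = (\<Sum>l\<in>L. (v l)\<^sup>2)"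
      using assms(1) by (simp add: orth power2_eq_square if_distrib cong: if_cong)
    finally show "(\<Sum>i\<in>I. (\<Sum>l\<in>L. z l i * v l)\<^sup>2) \<le> (\<Sum>l\<in>L. (v l)\<^sup>2)" by simp
  qed
  from contraction_mat_transpose[OF this] show ?thesis .
qed

definition projection_mat :: "'i set \<Rightarrow> ('i \<Rightarrow> 'i \<Rightarrow> real) \<Rightarrow> bool"
  where "projection_mat I P \<longleftrightarrow>
    (\<forall>i\<in>I. \<forall>j\<in>I. P i j = P j i \<and> (\<Sum>l\<in>I. P i l * P l j) = P i j)"

lemma projection_matD:
  assumes "projection_mat I P" "i \<in> I" "j \<in> I"
  shows "P i j = P j i" "(\<Sum>l\<in>I. P i l * P l j) = P i j"
  using assms unfolding projection_mat_def by blast+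

lemma projection_mat_diag:
  assumes P: "projection_mat I P" and i: "i \<in> I"
  shows "P i i = (\<Sum>j\<in>I. (P i j)\<^sup>2)"
proof -
  have "P i i = (\<Sum>l\<in>I. P i l * P l i)" using projection_matD[OF P i i] by simp
  also have "\<dots> = (\<Sum>j\<in>I. (P i j)\<^sup>2)"
    by (rule sum.cong) (use projection_matD(1)[OF P i] in \<open>auto simp: power2_eq_square\<close>)
  finally show ?thesis .
qed

lemma projection_mat_diag_eq_0:
  assumes P: "projection_mat I P" and "finite I" "i \<in> I" "j \<in> I" "P i i = 0"
  shows "P i j = 0"
  using projection_mat_diag[OF P \<open>i \<in> I\<close>] assms by (simp add: sum_nonneg_eq_0_iff)

text \<open>
  Both rank-one changes of an orthogonal projection by a unit vector \<open>z\<close> at once: \<open>d = 0\<close>, \<open>c = 1\<close>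
  adjoins a vector orthogonal to the range, \<open>d = 1\<close>, \<open>c = - 1\<close> splits off a vector of the range. In
  the square of \<open>P + c z z\<^sup>T\<close> the coefficient of \<open>z z\<^sup>T\<close> is \<open>2 c d + c\<^sup>2\<close>, which is \<open>c\<close>.
\<close>

lemma projection_mat_rank_one_update:
  assumes P: "projection_mat I P"
    and eig: "\<And>i. i \<in> I \<Longrightarrow> (\<Sum>j\<in>I. P i j * z j) = d * z i"
    and unit: "(\<Sum>i\<in>I. (z i)\<^sup>2) = 1"
    and c: "c = 1 - 2 * d"
  shows "projection_mat I (\<lambda>i j. P i j + c * z i * z j)"
    and "(\<Sum>i\<in>I. P i i + c * z i * z i) = (\<Sum>i\<in>I. P i i) + c"
proof -
  have "(\<Sum>l\<in>I. (P i l + c * z i * z l) * (P l j + c * z l * z j)) = P i j + c * z i * z j"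
    if i: "i \<in> I" and j: "j \<in> I" for i j
  proof -
    have "(\<Sum>l\<in>I. (P i l + c * z i * z l) * (P l j + c * z l * z j))
        = (\<Sum>l\<in>I. P i l * P l j + c * z j * (P i l * z l) + c * z i * (P j l * z l)
            + c * c * z i * z j * (z l)\<^sup>2)"
      by (rule sum.cong) (use projection_matD(1)[OF P _ j] in
          \<open>auto simp: algebra_simps power2_eq_square\<close>)
    also have "\<dots> = P i j + c * z j * (d * z i) + c * z i * (d * z j) + c * c * z i * z j"
      using projection_matD(2)[OF P i j] eig[OF i] eig[OF j] unit
      by (simp add: sum.distrib flip: sum_distrib_left)
    also have "\<dots> = P i j + c * z i * z j" unfolding c by (simp add: algebra_simps)
    finally show ?thesis .
  qed
  then show "projection_mat I (\<lambda>i j. P i j + c * z i * z j)"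
    using projection_matD(1)[OF P] by (simp add: projection_mat_def mult_ac)
  show "(\<Sum>i\<in>I. P i i + c * z i * z i) = (\<Sum>i\<in>I. P i i) + c"
    using unit by (simp add: sum.distrib power2_eq_square mult.assoc flip: sum_distrib_left)
qed

text \<open>
  Gram-Schmidt, phrased with projections instead of orthonormal bases: the part \<open>d\<close> of a new vector
  that the current projection does not see is normalised and adjoined.
\<close>

lemma ex_projection_mat_fixing:
  assumes "finite I" "finite B"
  shows "\<exists>P r. projection_mat I P \<and> (\<Sum>i\<in>I. P i i) = real r \<and> r \<le> card B \<and>
    (\<forall>\<beta>\<in>B. \<forall>i\<in>I. (\<Sum>j\<in>I. P i j * b \<beta> j) = b \<beta> i)"
  using assms(2)
proof (induction B rule: finite_induct)
  case empty
  have "projection_mat I (\<lambda>_ _. 0)" by (simp add: projection_mat_def)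
  then show ?case by (intro exI[of _ "\<lambda>_ _. 0"] exI[of _ 0]) simp
next
  case (insert \<beta> B)
  then obtain P r where P: "projection_mat I P" and tr: "(\<Sum>i\<in>I. P i i) = real r"
    and r: "r \<le> card B" and fix_B: "\<And>\<gamma> i. \<gamma> \<in> B \<Longrightarrow> i \<in> I \<Longrightarrow> (\<Sum>j\<in>I. P i j * b \<gamma> j) = b \<gamma> i"
    by blast
  define d where "d i = b \<beta> i - (\<Sum>j\<in>I. P i j * b \<beta> j)" for i
  define D where "D = (\<Sum>i\<in>I. (d i)\<^sup>2)"
  have Pd: "(\<Sum>j\<in>I. P i j * d j) = 0" if i: "i \<in> I" for i
  proof -
    have "(\<Sum>j\<in>I. P i j * (\<Sum>l\<in>I. P j l * b \<beta> l)) = (\<Sum>l\<in>I. (\<Sum>j\<in>I. P i j * P j l) * b \<beta> l)"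
      unfolding sum_distrib_left sum_distrib_right by (subst sum.swap) (simp add: mult_ac)
    also have "\<dots> = (\<Sum>l\<in>I. P i l * b \<beta> l)"
      by (rule sum.cong) (use projection_matD(2)[OF P i] in auto)
    finally show ?thesis by (simp add: d_def right_diff_distrib sum_subtractf)
  qed
  (* As P d = 0 and P is symmetric, pairing with d only sees v - P v. *)
  have db: "(\<Sum>j\<in>I. d j * v j) = (\<Sum>j\<in>I. d j * (v j - (\<Sum>l\<in>I. P j l * v l)))" for v
  proof -
    have "(\<Sum>j\<in>I. d j * (\<Sum>l\<in>I. P j l * v l)) = (\<Sum>l\<in>I. (\<Sum>j\<in>I. P l j * d j) * v l)"
      unfolding sum_distrib_left sum_distrib_right
      by (subst sum.swap, intro sum.cong refl) (use projection_matD(1)[OF P] in \<open>simp add: mult_ac\<close>)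
    also have "\<dots> = 0" by (simp add: Pd)
    finally show ?thesis by (simp add: right_diff_distrib sum_subtractf)
  qed
  show ?case
  proof (cases "D = 0")
    case True
    then have "d i = 0" if "i \<in> I" for i
      using that assms(1) by (simp add: D_def sum_nonneg_eq_0_iff)
    then have "(\<Sum>j\<in>I. P i j * b \<beta> j) = b \<beta> i" if "i \<in> I" for i using that by (simp add: d_def)
    then show ?thesis using P tr r fix_B insert.hyps
      by (intro exI[of _ P] exI[of _ r]) auto
  next
    case False
    moreover have "0 \<le> D" by (auto simp: D_def intro: sum_nonneg)
    ultimately have D: "0 < D" by simp
    define z where "z i = d i / sqrt D" for i
    define P' where "P' i j = P i j + 1 * z i * z j" for i j
    have Pz: "(\<Sum>j\<in>I. P i j * z j) = 0 * z i" if "i \<in> I" for i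
      using Pd[OF that] by (simp add: z_def flip: sum_divide_distrib)
    have z1: "(\<Sum>i\<in>I. (z i)\<^sup>2) = 1"
      using D by (simp add: z_def power_divide D_def[symmetric] flip: sum_divide_distrib)
    have P': "projection_mat I P'" and tr': "(\<Sum>i\<in>I. P' i i) = real r + 1"
      using projection_mat_rank_one_update[OF P Pz z1, of 1] tr by (simp_all add: P'_def[abs_def])
    have "(\<Sum>j\<in>I. P' i j * v j) = (\<Sum>j\<in>I. P i j * v j) + d i * (\<Sum>j\<in>I. d j * v j) / D" for i v
      using D by (simp add: P'_def z_def algebra_simps sum.distrib sum_distrib_left
          flip: sum_divide_distrib real_sqrt_mult)
    then have P'v: "(\<Sum>j\<in>I. P' i j * v j) = (\<Sum>j\<in>I. P i j * v j)
          + d i * (\<Sum>j\<in>I. d j * (v j - (\<Sum>l\<in>I. P j l * v l))) / D" for i v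
      by (simp only: db[of v])
    have "(\<Sum>j\<in>I. P' i j * b \<beta> j) = b \<beta> i" if "i \<in> I" for i
    proof -
      have "(\<Sum>j\<in>I. d j * (b \<beta> j - (\<Sum>l\<in>I. P j l * b \<beta> l))) = D"
        by (simp add: D_def d_def[symmetric] power2_eq_square)
      then show ?thesis using P'v[of i "b \<beta>"] D by (simp add: d_def)
    qed
    moreover have "(\<Sum>j\<in>I. P' i j * b \<gamma> j) = b \<gamma> i" if "\<gamma> \<in> B" "i \<in> I" for \<gamma> i
      using P'v[of i "b \<gamma>"] fix_B[OF that(1)] that(2) by simp
    ultimately show ?thesis using P' tr' r insert.hyps
      by (intro exI[of _ P'] exI[of _ "Suc r"]) auto
  qed
qed


section \<open>Reduction to few coordinates\<close>

text \<open>
  The heart of the proof. Write \<open>T v = \<Sum> v\<^sub>i y\<^sub>i\<close> and \<open>s\<close> for the double sum in the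
  conclusion, the trace of \<open>P\<close> against the matrix \<open>\<phi>\<^sub>i (y\<^sub>j)\<close>. An orthonormal basis of the range of
  \<open>P\<close> is chosen one vector at a time among the normalised columns \<open>z = P \<delta>\<^sub>m / \<surd>P\<^sub>m\<^sub>m\<close>, where column
  \<open>m\<close> is drawn with weight \<open>P\<^sub>m\<^sub>m\<close>, of total weight \<open>r + 1\<close> when \<open>P\<close> has rank \<open>r + 1\<close>. Splitting
  off \<open>z\<close> changes \<open>s\<close> to \<open>s - g\<^sub>m / P\<^sub>m\<^sub>m\<close>, where \<open>g\<^sub>m\<close> is the value of the bilinear form at
  \<open>P \<delta>\<^sub>m\<close>. Two sums decide: \<open>\<Sum> g\<^sub>m = s\<close> because \<open>P\<^sup>2 = P\<close>, and
  \<open>t \<Sum> \<parallel>T P \<delta>\<^sub>m\<parallel>\<^sup>2 \<ge> s\<^sup>2\<close> by Cauchy-Schwarz because \<open>s = \<Sum> \<phi>\<^sub>m (T P \<delta>\<^sub>m)\<close>. Hence some \<open>m\<close> has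
  \<open>s g\<^sub>m \<le> t \<parallel>T P \<delta>\<^sub>m\<parallel>\<^sup>2\<close>: the decrease of \<open>s\<^sup>2\<close>, which is at most \<open>2 s g\<^sub>m / P\<^sub>m\<^sub>m\<close>, is paid
  for by \<open>2 t \<parallel>T z\<parallel>\<^sup>2\<close>, and the induction hypothesis pays for the remaining square. The factor
  \<open>2\<close> is the one in the derivative of \<open>s\<^sup>2\<close>.

  That each \<open>z\<^sub>l\<close> is fixed by \<open>P\<close> is part of the induction: it makes later vectors orthogonal to the
  one split off.
\<close>

lemma orthonormal_selection:
  fixes y :: "'i \<Rightarrow> 'a::real_normed_vector" and \<phi> :: "'i \<Rightarrow> 'a \<Rightarrow>\<^sub>L real"
  assumes I: "finite I" and t: "(\<Sum>i\<in>I. (norm (\<phi> i))\<^sup>2) \<le> t"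
    and "projection_mat I P" "(\<Sum>i\<in>I. P i i) = real r"
  shows "\<exists>z. (\<forall>l<r. \<forall>l'<r. (\<Sum>i\<in>I. z l i * z l' i) = (if l = l' then 1 else 0)) \<and>
    (\<forall>l<r. \<forall>i\<in>I. (\<Sum>j\<in>I. P i j * z l j) = z l i) \<and>
    (\<Sum>i\<in>I. \<Sum>j\<in>I. P i j * \<phi> i (y j))\<^sup>2 \<le> 2 * t * (\<Sum>l<r. (norm (\<Sum>i\<in>I. z l i *\<^sub>R y i))\<^sup>2)"
  using assms(3,4)
proof (induction r arbitrary: P)
  case 0
  have "P i i = 0" if "i \<in> I" for i
    using 0 that I projection_mat_diag[OF 0(1)] by (simp add: sum_nonneg sum_nonneg_eq_0_iff)
  then have "P i j = 0" if "i \<in> I" "j \<in> I" for i j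
    using projection_mat_diag_eq_0[OF 0(1) I] that by blast
  then show ?case by simp
next
  case (Suc r)
  note P = Suc.prems(1)
  note sym = projection_matD(1)[OF P] and idem = projection_matD(2)[OF P]
  define s where "s = (\<Sum>i\<in>I. \<Sum>j\<in>I. P i j * \<phi> i (y j))"
  define T where "T v = (\<Sum>i\<in>I. v i *\<^sub>R y i)" for v
  define g where "g m = (\<Sum>i\<in>I. \<Sum>j\<in>I. P m i * P m j * \<phi> i (y j))" for m
  have t0: "0 \<le> t" using t sum_nonneg[of I "\<lambda>i. (norm (\<phi> i))\<^sup>2"] by auto
  have "s = (\<Sum>i\<in>I. \<phi> i (T (P i)))"
    by (simp add: s_def T_def blinfun.sum_right blinfun.scaleR_right)
  also have "\<bar>\<dots>\<bar> \<le> (\<Sum>i\<in>I. norm (\<phi> i) * norm (T (P i)))"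
  proof (rule order_trans[OF sum_abs sum_mono])
    show "\<bar>\<phi> i (T (P i))\<bar> \<le> norm (\<phi> i) * norm (T (P i))" for i
      using norm_blinfun[of "\<phi> i" "T (P i)"] by simp
  qed
  finally have "s\<^sup>2 \<le> (\<Sum>i\<in>I. norm (\<phi> i) * norm (T (P i)))\<^sup>2"
    by (metis abs_ge_zero power2_abs power_mono)
  also have "\<dots> \<le> (\<Sum>i\<in>I. (norm (\<phi> i))\<^sup>2) * (\<Sum>i\<in>I. (norm (T (P i)))\<^sup>2)"
    by (rule Cauchy_Schwarz_ineq_sum)
  also have "\<dots> \<le> t * (\<Sum>i\<in>I. (norm (T (P i)))\<^sup>2)"
    by (intro mult_right_mono t sum_nonneg) auto
  finally have gain: "s\<^sup>2 \<le> (\<Sum>i\<in>I. t * (norm (T (P i)))\<^sup>2)" by (simp add: sum_distrib_left)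
  have "(\<Sum>m\<in>I. g m) = (\<Sum>i\<in>I. \<Sum>j\<in>I. \<Sum>m\<in>I. P m i * P m j * \<phi> i (y j))"
    unfolding g_def by (subst sum.swap, rule sum.cong[OF refl], subst sum.swap) simp
  also have "\<dots> = (\<Sum>i\<in>I. \<Sum>j\<in>I. (\<Sum>m\<in>I. P i m * P m j) * \<phi> i (y j))"
    by (intro sum.cong refl) (simp add: sum_distrib_right sym cong: sum.cong)
  also have "\<dots> = s" unfolding s_def by (intro sum.cong refl) (simp add: idem)
  finally have loss: "(\<Sum>m\<in>I. s * g m) = s\<^sup>2" by (simp add: power2_eq_square flip: sum_distrib_left)
  have diag: "0 \<le> P m m" if "m \<in> I" for m
    using projection_mat_diag[OF P that] by (simp add: sum_nonneg)
  have "\<exists>m\<in>I. 0 < P m m \<and> s * g m \<le> t * (norm (T (P m)))\<^sup>2"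
  proof (rule ccontr)
    assume "\<not> ?thesis"
    then have less: "t * (norm (T (P m)))\<^sup>2 < s * g m" if "m \<in> I" "0 < P m m" for m
      using that by force
    (* A vanishing diagonal entry forces the whole row to vanish. *)
    have eq: "t * (norm (T (P m)))\<^sup>2 = s * g m" if "m \<in> I" "P m m = 0" for m
      using projection_mat_diag_eq_0[OF P I that(1) _ that(2)] by (simp add: T_def g_def)
    have "\<exists>m\<in>I. 0 < P m m"
    proof (rule ccontr)
      assume "\<not> ?thesis"
      then have "(\<Sum>i\<in>I. P i i) \<le> 0" by (intro sum_nonpos) auto
      with Suc.prems(2) show False by simp
    qed
    then have "(\<Sum>m\<in>I. t * (norm (T (P m)))\<^sup>2) < (\<Sum>m\<in>I. s * g m)"
      using I less eq diag by (intro sum_strict_mono_ex1) (auto simp: le_less)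
    with gain loss show False by simp
  qed
  then obtain m where m: "m \<in> I" "0 < P m m" "s * g m \<le> t * (norm (T (P m)))\<^sup>2" by blast
  define z0 where "z0 i = P m i / sqrt (P m m)" for i
  define P' where "P' i j = P i j + (- 1) * z0 i * z0 j" for i j
  have Pz0: "(\<Sum>j\<in>I. P i j * z0 j) = 1 * z0 i" if i: "i \<in> I" for i
  proof -
    have "(\<Sum>j\<in>I. P i j * P m j) = (\<Sum>j\<in>I. P m j * P j i)"
      by (intro sum.cong refl) (use sym[OF i] in simp)
    then show ?thesis using idem[OF m(1) i] by (simp add: z0_def flip: sum_divide_distrib)
  qed
  have z0_unit: "(\<Sum>i\<in>I. (z0 i)\<^sup>2) = 1"
    using m(2) projection_mat_diag[OF P m(1)]
    by (simp add: z0_def power_divide flip: sum_divide_distrib)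
  have P': "projection_mat I P'" and "(\<Sum>i\<in>I. P' i i) = real r"
    using projection_mat_rank_one_update[OF P Pz0 z0_unit, of "- 1"] Suc.prems(2)
    by (simp_all add: P'_def[abs_def])
  from Suc.IH[OF this] obtain z where
    orth: "\<And>l l'. l < r \<Longrightarrow> l' < r \<Longrightarrow> (\<Sum>i\<in>I. z l i * z l' i) = (if l = l' then 1 else 0)"
    and ran: "\<And>l i. l < r \<Longrightarrow> i \<in> I \<Longrightarrow> (\<Sum>j\<in>I. P' i j * z l j) = z l i"
    and IH: "(\<Sum>i\<in>I. \<Sum>j\<in>I. P' i j * \<phi> i (y j))\<^sup>2 \<le> 2 * t * (\<Sum>l<r. (norm (T (z l)))\<^sup>2)"
    unfolding T_def by blast
  have z0_orth: "(\<Sum>i\<in>I. z0 i * z l i) = 0" if l: "l < r" for l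
  proof -
    have P'z0: "(\<Sum>i\<in>I. z0 i * P' i j) = 0" if j: "j \<in> I" for j
    proof -
      have "(\<Sum>i\<in>I. z0 i * P' i j) = (\<Sum>i\<in>I. P j i * z0 i) - z0 j * (\<Sum>i\<in>I. (z0 i)\<^sup>2)"
        unfolding sum_distrib_left sum_subtractf[symmetric]
        by (intro sum.cong refl) (use sym[OF j] in \<open>simp add: P'_def algebra_simps power2_eq_square\<close>)
      then show ?thesis using Pz0[OF j] z0_unit by simp
    qed
    have "(\<Sum>i\<in>I. z0 i * z l i) = (\<Sum>i\<in>I. z0 i * (\<Sum>j\<in>I. P' i j * z l j))"
      by (intro sum.cong refl) (simp add: ran[OF l])
    also have "\<dots> = (\<Sum>j\<in>I. (\<Sum>i\<in>I. z0 i * P' i j) * z l j)"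
      unfolding sum_distrib_left sum_distrib_right by (subst sum.swap) (simp add: mult_ac)
    also have "\<dots> = 0" by (simp add: P'z0)
    finally show ?thesis .
  qed
  define Z where "Z = z(r := z0)"
  have Z: "Z r = z0" "\<And>l. l < r \<Longrightarrow> Z l = z l" by (auto simp: Z_def)
  have "(\<Sum>i\<in>I. Z l i * Z l' i) = (if l = l' then 1 else 0)" if "l < Suc r" "l' < Suc r" for l l'
    using that orth z0_orth z0_unit
    by (auto simp: less_Suc_eq Z power2_eq_square mult.commute)
  moreover have "(\<Sum>j\<in>I. P i j * Z l j) = Z l i" if "l < Suc r" "i \<in> I" for l i
  proof (cases "l = r")
    case True
    then show ?thesis using Pz0[OF that(2)] by (simp add: Z)
  next
    case False
    then have l: "l < r" using that by simp
    have "(\<Sum>j\<in>I. P i j * z l j) = (\<Sum>j\<in>I. P' i j * z l j) + z0 i * (\<Sum>j\<in>I. z0 j * z l j)"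
      unfolding sum_distrib_left sum.distrib[symmetric]
      by (intro sum.cong refl) (simp add: P'_def algebra_simps)
    then show ?thesis using ran[OF l that(2)] z0_orth[OF l] by (simp add: Z l)
  qed
  moreover have "s\<^sup>2 \<le> 2 * t * (\<Sum>l<Suc r. (norm (T (Z l)))\<^sup>2)"
  proof -
    define p where "p = P m m"
    have p: "0 < p" using m by (simp add: p_def)
    have s': "(\<Sum>i\<in>I. \<Sum>j\<in>I. P' i j * \<phi> i (y j)) = s - g m / p"
    proof -
      have "P' i j = P i j - P m i * P m j / p" for i j
        using p by (simp add: P'_def z0_def p_def flip: real_sqrt_mult)
      then show ?thesis
        by (simp add: s_def g_def left_diff_distrib sum_subtractf flip: sum_divide_distrib)
    qed
    have "T z0 = (1 / sqrt p) *\<^sub>R T (P m)"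
      by (simp add: T_def z0_def p_def scaleR_sum_right)
    then have Tz0: "(norm (T z0))\<^sup>2 = (norm (T (P m)))\<^sup>2 / p"
      using p by (simp add: power_mult_distrib power_divide)
    (* The choice of m bounds the first-order part of the decrease of s^2 by the gain at z0. *)
    have trade: "2 * (s * g m) / p \<le> 2 * (t * (norm (T (P m)))\<^sup>2) / p"
      using m(3) p by (intro divide_right_mono) auto
    have "s\<^sup>2 = 2 * (s * g m) / p + (s - g m / p)\<^sup>2 - (g m / p)\<^sup>2"
      by (simp add: power2_eq_square algebra_simps)
    also have "\<dots> \<le> 2 * (t * (norm (T (P m)))\<^sup>2) / p + (s - g m / p)\<^sup>2"
      using trade zero_le_power2[of "g m / p"] by linarith
    also have "\<dots> \<le> 2 * t * (norm (T z0))\<^sup>2 + 2 * t * (\<Sum>l<r. (norm (T (z l)))\<^sup>2)"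
      using IH by (simp add: s' Tz0)
    finally show ?thesis by (simp add: Z algebra_simps)
  qed
  ultimately show ?case unfolding s_def T_def by blast
qed

text \<open>
  In essence the theorem of Tomczak-Jaegermann that \<open>k\<close> vectors suffice to compute the 2-summing norm
  of a rank \<open>k\<close> operator up to the factor \<open>\<surd>2\<close>. The projection \<open>P\<close> fixes
  all coefficient vectors \<open>b\<^sub>\<beta>\<close>, so it fixes \<open>y\<close>, and if \<open>\<phi>\<^sub>i\<close> norms \<open>y\<^sub>i\<close>, then \<open>s\<close> in
  \<^emph>\<open>orthonormal_selection\<close> equals \<open>t = \<Sum> \<parallel>y\<^sub>i\<parallel>\<^sup>2\<close>.
\<close>

lemma few_coordinates_suffice:
  fixes y :: "'i \<Rightarrow> 'a::real_normed_vector"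
  assumes I: "finite I" and B: "finite B" "card B \<le> k"
    and y: "\<And>i. i \<in> I \<Longrightarrow> y i = (\<Sum>\<beta>\<in>B. b \<beta> i *\<^sub>R w \<beta>)"
  obtains Z where "contraction_mat {..<k} I Z"
    "L2_set (\<lambda>i. norm (y i)) I \<le> sqrt 2 * L2_set (\<lambda>l. norm (\<Sum>i\<in>I. Z l i *\<^sub>R y i)) {..<k}"
proof -
  define t where "t = (\<Sum>i\<in>I. (norm (y i))\<^sup>2)"
  have "\<exists>\<phi>. norm \<phi> \<le> norm (y i) \<and> blinfun_apply \<phi> (y i) = (norm (y i))\<^sup>2" for i
    using duality_map[of "y i"] by blast
  then obtain \<phi> where \<phi>: "\<And>i. norm (\<phi> i) \<le> norm (y i)"
      "\<And>i. blinfun_apply (\<phi> i) (y i) = (norm (y i))\<^sup>2"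
    by metis
  have le_t: "(\<Sum>i\<in>I. (norm (\<phi> i))\<^sup>2) \<le> t"
    unfolding t_def by (intro sum_mono power_mono \<phi>) simp
  obtain P r where P: "projection_mat I P" "(\<Sum>i\<in>I. P i i) = real r" and r: "r \<le> card B"
    and fix_b: "\<And>\<beta> i. \<beta> \<in> B \<Longrightarrow> i \<in> I \<Longrightarrow> (\<Sum>j\<in>I. P i j * b \<beta> j) = b \<beta> i"
    using ex_projection_mat_fixing[OF I B(1), of b] by blast
  have Py: "(\<Sum>j\<in>I. P i j *\<^sub>R y j) = y i" if i: "i \<in> I" for i
  proof -
    have "(\<Sum>j\<in>I. P i j *\<^sub>R y j) = (\<Sum>j\<in>I. \<Sum>\<beta>\<in>B. (P i j * b \<beta> j) *\<^sub>R w \<beta>)"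
      by (simp add: y scaleR_sum_right)
    also have "\<dots> = (\<Sum>\<beta>\<in>B. (\<Sum>j\<in>I. P i j * b \<beta> j) *\<^sub>R w \<beta>)"
      by (subst sum.swap) (simp add: scaleR_sum_left)
    also have "\<dots> = y i" by (simp add: fix_b i y)
    finally show ?thesis .
  qed
  have s: "(\<Sum>i\<in>I. \<Sum>j\<in>I. P i j * \<phi> i (y j)) = t"
  proof -
    have "(\<Sum>j\<in>I. P i j * \<phi> i (y j)) = (norm (y i))\<^sup>2" if "i \<in> I" for i
      using arg_cong[OF Py[OF that], of "blinfun_apply (\<phi> i)"]
      by (simp add: blinfun.sum_right blinfun.scaleR_right \<phi>)
    then show ?thesis by (simp add: t_def)
  qed
  obtain z where
    orth: "\<And>l l'. l < r \<Longrightarrow> l' < r \<Longrightarrow> (\<Sum>i\<in>I. z l i * z l' i) = (if l = l' then 1 else 0)"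
    and le: "t\<^sup>2 \<le> 2 * t * (\<Sum>l<r. (norm (\<Sum>i\<in>I. z l i *\<^sub>R y i))\<^sup>2)"
    using orthonormal_selection[OF I le_t P, of y] unfolding s by blast
  (* The rank r of P can be smaller than k; zero rows keep Z a contraction. *)
  define Z where "Z l i = (if l < r then z l i else 0)" for l i
  have pad: "(\<Sum>l<k. f l) = (\<Sum>l<r. f l)" if "\<And>l. r \<le> l \<Longrightarrow> f l = 0" for f :: "nat \<Rightarrow> real"
    using r B that by (intro sum.mono_neutral_right) auto
  have "contraction_mat {..<r} I z"
    by (rule contraction_mat_orthonormal_rows) (use orth in auto)
  then have "contraction_mat {..<k} I Z"
    by (simp add: contraction_mat_def pad Z_def)
  moreover have "t \<le> 2 * (\<Sum>l<k. (norm (\<Sum>i\<in>I. Z l i *\<^sub>R y i))\<^sup>2)"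
  proof -
    define S where "S = (\<Sum>l<r. (norm (\<Sum>i\<in>I. z l i *\<^sub>R y i))\<^sup>2)"
    have "t * t \<le> t * (2 * S)" using le by (simp add: S_def power2_eq_square mult_ac)
    moreover have "0 \<le> t" "0 \<le> S" by (auto simp: t_def S_def intro: sum_nonneg)
    ultimately have "t \<le> 2 * S" by (cases "t = 0") (auto simp: mult_le_cancel_left)
    then show ?thesis by (simp add: pad Z_def S_def)
  qed
  then have "L2_set (\<lambda>i. norm (y i)) I \<le> sqrt 2 * L2_set (\<lambda>l. norm (\<Sum>i\<in>I. Z l i *\<^sub>R y i)) {..<k}"
    unfolding L2_set_def t_def real_sqrt_mult[symmetric] by (rule real_sqrt_le_mono)
  ultimately show ?thesis by (rule that)
qed


section \<open>Matrices of low rank and duality\<close>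

text \<open>
  The norm of a functional need not be attained, which costs a factor \<open>q\<close> arbitrarily close to \<open>1\<close>.
\<close>

lemma ex_almost_norming:
  fixes \<theta> :: "'a::real_normed_vector \<Rightarrow>\<^sub>L real"
  assumes q: "0 < q" "q < 1"
  shows "\<exists>x. norm x \<le> norm \<theta> \<and> q * (norm \<theta>)\<^sup>2 \<le> \<theta> x"
proof (rule ccontr)
  assume "\<not> ?thesis"
  then have less: "\<theta> x < q * (norm \<theta>)\<^sup>2" if "norm x \<le> norm \<theta>" for x
    using that by force
  from less[of 0] have \<theta>: "0 < norm \<theta>" by auto
  have le: "\<theta> v \<le> q * norm \<theta> * norm v" for v
  proof (cases "v = 0")
    case False
    have "\<theta> ((norm \<theta> / norm v) *\<^sub>R v) < q * (norm \<theta>)\<^sup>2" by (rule less) (use False in simp)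
    then show ?thesis using False \<theta>
      by (simp add: blinfun.scaleR_right power2_eq_square field_simps)
  qed simp
  have "norm \<theta> \<le> q * norm \<theta>"
  proof (rule norm_blinfun_bound)
    show "norm (\<theta> v) \<le> q * norm \<theta> * norm v" for v
      using le[of v] le[of "- v"] by (simp add: blinfun.minus_right abs_le_iff)
  qed (use q in simp)
  with \<theta> q show False by simp
qed

lemma sum_blinfun_le:
  fixes \<eta> :: "'i \<Rightarrow> 'a::real_normed_vector \<Rightarrow>\<^sub>L real"
  shows "(\<Sum>i\<in>I. \<eta> i (x i)) \<le> L2_set (\<lambda>i. norm (\<eta> i)) I * L2_set (\<lambda>i. norm (x i)) I"
proof -
  have "\<eta> i (x i) \<le> \<bar>norm (\<eta> i)\<bar> * \<bar>norm (x i)\<bar>" for i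
    using norm_blinfun[of "\<eta> i" "x i"] by simp
  then have "(\<Sum>i\<in>I. \<eta> i (x i)) \<le> (\<Sum>i\<in>I. \<bar>norm (\<eta> i)\<bar> * \<bar>norm (x i)\<bar>)" by (rule sum_mono)
  also have "\<dots> \<le> L2_set (\<lambda>i. norm (\<eta> i)) I * L2_set (\<lambda>i. norm (x i)) I" by (rule L2_set_mult_ineq)
  finally show ?thesis .
qed

lemma sum_blinfun_transpose:
  fixes \<eta> :: "'j \<Rightarrow> 'a::real_normed_vector \<Rightarrow>\<^sub>L real"
  shows "(\<Sum>i\<in>I. (\<Sum>j\<in>J. a i j *\<^sub>R \<eta> j) (x i)) = (\<Sum>j\<in>J. \<eta> j (\<Sum>i\<in>I. a i j *\<^sub>R x i))"
  by (simp add: blinfun.sum_left blinfun.scaleR_left blinfun.sum_right blinfun.scaleR_right)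
     (rule sum.swap)

text \<open>
  The transposed matrix acts on \<open>X\<^sup>*\<close>-valued sequences with at most the norm of the matrix on
  \<open>X\<close>-valued ones: pair the image \<open>\<theta>\<close> with a sequence that almost norms it, and move the matrix
  to the other side.
\<close>

lemma dual_amplification_le:
  fixes \<eta> :: "'j \<Rightarrow> 'a::real_normed_vector \<Rightarrow>\<^sub>L real"
  assumes bound: "\<And>x :: 'i \<Rightarrow> 'a.
    L2_set (\<lambda>j. norm (\<Sum>i\<in>I. a i j *\<^sub>R x i)) J \<le> c * L2_set (\<lambda>i. norm (x i)) I"
    and c: "0 \<le> c"
  shows "L2_set (\<lambda>i. norm (\<Sum>j\<in>J. a i j *\<^sub>R \<eta> j)) I \<le> c * L2_set (\<lambda>j. norm (\<eta> j)) J"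
proof -
  define \<theta> where "\<theta> i = (\<Sum>j\<in>J. a i j *\<^sub>R \<eta> j)" for i
  define \<Theta> where "\<Theta> = L2_set (\<lambda>i. norm (\<theta> i)) I"
  define L where "L = L2_set (\<lambda>j. norm (\<eta> j)) J"
  have L: "0 \<le> L" and \<Theta>: "0 \<le> \<Theta>" by (auto simp: L_def \<Theta>_def)
  have "q * \<Theta>\<^sup>2 \<le> c * L * \<Theta>" if q: "0 < q" "q < 1" for q
  proof -
    have "\<forall>i. \<exists>v. norm v \<le> norm (\<theta> i) \<and> q * (norm (\<theta> i))\<^sup>2 \<le> \<theta> i v"
      by (intro allI ex_almost_norming q)
    from choice[OF this] obtain x
      where x: "\<And>i. norm (x i) \<le> norm (\<theta> i)" "\<And>i. q * (norm (\<theta> i))\<^sup>2 \<le> \<theta> i (x i)"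
      by blast
    have "q * \<Theta>\<^sup>2 = (\<Sum>i\<in>I. q * (norm (\<theta> i))\<^sup>2)"
      by (simp add: \<Theta>_def L2_set_def sum_nonneg sum_distrib_left)
    also have "\<dots> \<le> (\<Sum>i\<in>I. \<theta> i (x i))" by (rule sum_mono) (rule x)
    also have "\<dots> = (\<Sum>j\<in>J. \<eta> j (\<Sum>i\<in>I. a i j *\<^sub>R x i))"
      unfolding \<theta>_def by (rule sum_blinfun_transpose)
    also have "\<dots> \<le> L * L2_set (\<lambda>j. norm (\<Sum>i\<in>I. a i j *\<^sub>R x i)) J"
      unfolding L_def by (rule sum_blinfun_le)
    also have "\<dots> \<le> L * (c * L2_set (\<lambda>i. norm (x i)) I)" by (intro mult_left_mono bound L)
    also have "\<dots> \<le> L * (c * \<Theta>)"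
      unfolding \<Theta>_def by (intro mult_left_mono L c L2_set_mono x) auto
    finally show ?thesis by (simp add: mult_ac)
  qed
  then have "\<Theta>\<^sup>2 \<le> c * L * \<Theta>" by (rule field_le_mult_one_interval)
  then have "\<Theta> \<le> c * L" using \<Theta> L c
    by (cases "\<Theta> = 0") (auto simp: power2_eq_square mult_le_cancel_right)
  then show ?thesis by (simp add: \<Theta>_def \<theta>_def L_def)
qed

text \<open>
  Selection is used twice. On the range side, it replaces \<open>u\<close> by \<open>W = Z u\<close>, which has only \<open>k\<close>
  rows. On the domain side it is applied in the dual space \<open>X\<^sup>*\<close>: the adjoint of \<open>W\<close> has rank at most
  \<open>k\<close>, and after selection only the \<open>k \<times> k\<close> contraction \<open>a = Z' W\<^sup>T\<close> remains. Each use costs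
  \<open>\<surd>2\<close>.
\<close>

lemma rank_amplification_le:
  fixes x :: "'j \<Rightarrow> 'a::real_normed_vector"
  assumes bound: "\<And>(a :: nat \<Rightarrow> nat \<Rightarrow> real) (x :: nat \<Rightarrow> 'a). contraction_mat {..<k} {..<k} a \<Longrightarrow>
      L2_set (\<lambda>i. norm (\<Sum>j<k. a i j *\<^sub>R x j)) {..<k} \<le> c * L2_set (\<lambda>i. norm (x i)) {..<k}"
    and c: "0 \<le> c" and fin: "finite I" "finite J" "finite B" "card B \<le> k"
    and u: "contraction_mat I J u" "\<And>i j. i \<in> I \<Longrightarrow> j \<in> J \<Longrightarrow> u i j = (\<Sum>\<beta>\<in>B. b \<beta> i * w \<beta> j)"
  shows "L2_set (\<lambda>i. norm (\<Sum>j\<in>J. u i j *\<^sub>R x j)) I \<le> 2 * c * L2_set (\<lambda>j. norm (x j)) J"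
proof -
  define y where "y i = (\<Sum>j\<in>J. u i j *\<^sub>R x j)" for i
  define X where "X = L2_set (\<lambda>j. norm (x j)) J"
  have X: "0 \<le> X" by (simp add: X_def)
  have "y i = (\<Sum>\<beta>\<in>B. b \<beta> i *\<^sub>R (\<Sum>j\<in>J. w \<beta> j *\<^sub>R x j))" if "i \<in> I" for i
    by (simp add: y_def u(2) that scaleR_sum_left scaleR_sum_right) (rule sum.swap)
  then obtain Z where Z: "contraction_mat {..<k} I Z"
    and yZ: "L2_set (\<lambda>i. norm (y i)) I \<le> sqrt 2 * L2_set (\<lambda>l. norm (\<Sum>i\<in>I. Z l i *\<^sub>R y i)) {..<k}"
    using few_coordinates_suffice[of I B k y b "\<lambda>\<beta>. \<Sum>j\<in>J. w \<beta> j *\<^sub>R x j"] fin by blast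
  define W where "W l j = (\<Sum>i\<in>I. Z l i * u i j)" for l j
  have W: "contraction_mat {..<k} J W"
    unfolding W_def by (rule contraction_mat_mult[OF Z u(1)])
  define v where "v l = (\<Sum>j\<in>J. W l j *\<^sub>R x j)" for l
  have v: "(\<Sum>i\<in>I. Z l i *\<^sub>R y i) = v l" for l
    by (simp add: v_def W_def y_def scaleR_sum_left scaleR_sum_right) (rule sum.swap)
  define L where "L = L2_set (\<lambda>l. norm (v l)) {..<k}"
  have L: "0 \<le> L" by (simp add: L_def)
  have "\<exists>\<eta>. norm \<eta> \<le> norm (v l) \<and> blinfun_apply \<eta> (v l) = (norm (v l))\<^sup>2" for l
    using duality_map[of "v l"] by blast
  then obtain \<eta> where \<eta>: "\<And>l. norm (\<eta> l) \<le> norm (v l)"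
      "\<And>l. blinfun_apply (\<eta> l) (v l) = (norm (v l))\<^sup>2"
    by metis
  define \<psi> where "\<psi> j = (\<Sum>l<k. W l j *\<^sub>R \<eta> l)" for j
  obtain Z' where Z': "contraction_mat {..<k} J Z'"
    and \<psi>Z': "L2_set (\<lambda>j. norm (\<psi> j)) J \<le> sqrt 2 * L2_set (\<lambda>m. norm (\<Sum>j\<in>J. Z' m j *\<^sub>R \<psi> j)) {..<k}"
    using few_coordinates_suffice[of J "{..<k}" k \<psi> W \<eta>] fin by (auto simp: \<psi>_def)
  define a where "a m l = (\<Sum>j\<in>J. Z' m j * W l j)" for m l
  have a: "contraction_mat {..<k} {..<k} a"
    unfolding a_def by (rule contraction_mat_mult[OF Z' contraction_mat_transpose[OF W]])
  have "(\<Sum>j\<in>J. Z' m j *\<^sub>R \<psi> j) = (\<Sum>l<k. a m l *\<^sub>R \<eta> l)" for m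
    by (simp add: \<psi>_def a_def scaleR_sum_left scaleR_sum_right) (rule sum.swap)
  moreover have "L2_set (\<lambda>m. norm (\<Sum>l<k. a m l *\<^sub>R \<eta> l)) {..<k} \<le> c * L2_set (\<lambda>l. norm (\<eta> l)) {..<k}"
    by (rule dual_amplification_le[OF bound[OF contraction_mat_transpose[OF a]] c])
  ultimately have "L2_set (\<lambda>j. norm (\<psi> j)) J \<le> sqrt 2 * (c * L2_set (\<lambda>l. norm (\<eta> l)) {..<k})"
    using order_trans[OF \<psi>Z' mult_left_mono] by simp
  also have "\<dots> \<le> sqrt 2 * (c * L)"
    unfolding L_def by (intro mult_left_mono c L2_set_mono \<eta>) auto
  finally have \<psi>: "L2_set (\<lambda>j. norm (\<psi> j)) J \<le> sqrt 2 * (c * L)" .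
  (* The functionals psi are chosen so that pairing them with x gives the squared norm of v; a bound on
     psi therefore bounds v. *)
  have "L * L = (\<Sum>l<k. \<eta> l (v l))"
    by (simp add: L_def L2_set_def \<eta> sum_nonneg)
  also have "\<dots> = (\<Sum>j\<in>J. \<psi> j (x j))"
    unfolding v_def \<psi>_def by (rule sum_blinfun_transpose[symmetric])
  also have "\<dots> \<le> L2_set (\<lambda>j. norm (\<psi> j)) J * X" unfolding X_def by (rule sum_blinfun_le)
  also have "\<dots> \<le> sqrt 2 * (c * L) * X" by (rule mult_right_mono[OF \<psi> X])
  finally have "L * L \<le> (sqrt 2 * c * X) * L" by (simp add: mult_ac)
  then have "L \<le> sqrt 2 * c * X"
    using L X c by (cases "L = 0") (auto simp: mult_le_cancel_right)
  then have "sqrt 2 * L \<le> sqrt 2 * (sqrt 2 * c * X)" by (intro mult_left_mono) auto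
  also have "\<dots> = 2 * c * X" by simp
  finally have "L2_set (\<lambda>i. norm (y i)) I \<le> 2 * c * X" using yZ by (simp add: v L_def)
  then show ?thesis by (simp add: y_def X_def)
qed


section \<open>Passage to square-summable sequences\<close>

lemma L2_set_l2_nth_le: "L2_set (\<lambda>n. norm (l2_nth x n)) {..<N} \<le> norm x"
  unfolding norm_l2.rep_eq using l2_nth[of x] by (intro L2_set_le_sqrt_suminf) simp

lemma norm_l2_fin:
  assumes "x \<in> l2_fin k"
  shows "norm x = L2_set (\<lambda>n. norm (l2_nth x n)) {..<k}"
proof -
  have "(\<Sum>n. (norm (l2_nth x n))\<^sup>2) = (\<Sum>n<k. (norm (l2_nth x n))\<^sup>2)"
    by (rule suminf_finite) (use assms in \<open>auto simp: l2_fin_def\<close>)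
  then show ?thesis by (simp add: norm_l2.rep_eq L2_set_def)
qed

lemma l2_nth_Abs_l2_fin:
  assumes "\<And>n. k \<le> n \<Longrightarrow> f n = 0"
  shows "l2_nth (Abs_l2 f) = f"
proof -
  have "summable (\<lambda>n. (norm (f n))\<^sup>2)"
    by (rule summable_finite[of "{..<k}"]) (use assms in \<open>auto simp: not_less\<close>)
  then show ?thesis by (simp add: Abs_l2_inverse)
qed

lemma norm_tensor_Id_le:
  fixes x :: "'a::banach l2"
  assumes "\<And>N. L2_set (\<lambda>m. norm (\<Sum>n. l2_nth (u (l2_unit n)) m *\<^sub>R l2_nth x n)) {..<N} \<le> C"
  shows "norm (tensor_Id u x) \<le> C"
  using sqrt_suminf_le[OF assms] by (simp add: tensor_Id_def norm_l2.rep_eq Abs_l2_inverse)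

lemma onorm_on_le:
  assumes "\<And>x. x \<in> S \<Longrightarrow> norm (f x) \<le> c * norm x" "0 \<le> c"
  shows "onorm_on S f \<le> ennreal c"
  unfolding onorm_on_def
proof (rule SUP_least)
  fix x assume "x \<in> S"
  then show "ennreal (norm (f x) / norm x) \<le> ennreal c"
    using assms by (cases "x = 0") (auto intro!: ennreal_leI simp: divide_le_eq)
qed

lemma norm_le_of_onorm_on:
  assumes le: "onorm_on S f \<le> ennreal c" and "x \<in> S" "0 \<le> c" "x = 0 \<Longrightarrow> f x = 0"
  shows "norm (f x) \<le> c * norm x"
proof (cases "x = 0")
  case False
  have "ennreal (norm (f x) / norm x) \<le> ennreal c"
    using le SUP_upper[OF \<open>x \<in> S\<close>, of "\<lambda>x. ennreal (norm (f x) / norm x)"]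
    unfolding onorm_on_def by (rule order_trans[rotated])
  then have "norm (f x) / norm x \<le> c" using \<open>0 \<le> c\<close> by simp
  then show ?thesis using False by (simp add: divide_le_eq)
qed (use assms in simp)

lemma linear_between_0: "linear_between S T f \<Longrightarrow> 0 \<in> S \<Longrightarrow> f 0 = 0"
  unfolding linear_between_def by (metis scale_zero_left)

lemma linear_between_sum:
  assumes S: "subspace S" and f: "linear_between S T f" and A: "\<And>i. i \<in> A \<Longrightarrow> x i \<in> S"
  shows "f (\<Sum>i\<in>A. c i *\<^sub>R x i) = (\<Sum>i\<in>A. c i *\<^sub>R f (x i))"
  using A
proof (induction A rule: infinite_finite_induct)
  case (insert i A)
  have "(\<Sum>i\<in>A. c i *\<^sub>R x i) \<in> S"
    using S insert.prems by (intro subspace_sum subspace_scale) auto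
  moreover have "x i \<in> S" "c i *\<^sub>R x i \<in> S" using S insert.prems by (auto intro: subspace_scale)
  ultimately show ?case using insert f by (simp add: linear_between_def)
qed (use linear_between_0[OF f subspace_0[OF S]] in auto)

lemma subspace_l2_fin: "subspace (l2_fin k)"
  by (auto simp: subspace_def l2_fin_def zero_l2.rep_eq plus_l2.rep_eq scaleR_l2.rep_eq)

lemma l2_unit_in_l2_fin: "n < k \<Longrightarrow> l2_unit n \<in> l2_fin k"
  by (simp add: l2_fin_def l2_unit.rep_eq)

lemma l2_nth_sum_units:
  "finite A \<Longrightarrow> l2_nth (\<Sum>n\<in>A. v n *\<^sub>R l2_unit n) m = (if m \<in> A then v m else 0)"
  by (simp add: l2_nth_sum scaleR_l2.rep_eq l2_unit.rep_eq if_distrib cong: if_cong)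

lemma contraction_mat_of_linear_between:
  assumes a: "linear_between (l2_fin k) (l2_fin k) a" and norm: "onorm_on (l2_fin k) a \<le> 1"
  shows "contraction_mat {..<k} {..<k} (\<lambda>m n. l2_nth (a (l2_unit n)) m)"
  unfolding contraction_mat_def
proof
  fix v :: "nat \<Rightarrow> real"
  define \<xi> where "\<xi> = (\<Sum>n<k. v n *\<^sub>R l2_unit n)"
  have \<xi>: "\<xi> \<in> l2_fin k"
    unfolding \<xi>_def
    by (intro subspace_sum subspace_l2_fin subspace_scale l2_unit_in_l2_fin) auto
  have \<xi>_nth: "l2_nth \<xi> m = v m" if "m < k" for m
    using that by (simp add: \<xi>_def l2_nth_sum_units)
  have "a \<xi> = (\<Sum>n<k. v n *\<^sub>R a (l2_unit n))"
    unfolding \<xi>_def by (rule linear_between_sum[OF subspace_l2_fin a]) (simp add: l2_unit_in_l2_fin)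
  then have a\<xi>: "l2_nth (a \<xi>) m = (\<Sum>n<k. l2_nth (a (l2_unit n)) m * v n)" for m
    by (simp add: l2_nth_sum scaleR_l2.rep_eq mult.commute)
  have "a \<xi> \<in> l2_fin k" using a \<xi> by (auto simp: linear_between_def)
  moreover have "norm (a \<xi>) \<le> 1 * norm \<xi>"
    by (rule norm_le_of_onorm_on) (use norm \<xi> linear_between_0[OF a] in auto)
  ultimately have "L2_set (\<lambda>m. \<Sum>n<k. l2_nth (a (l2_unit n)) m * v n) {..<k} \<le> L2_set v {..<k}"
    using norm_l2_fin[OF \<xi>] \<xi>_nth by (simp add: norm_l2_fin a\<xi> L2_set_def)
  then show "(\<Sum>m<k. (\<Sum>n<k. l2_nth (a (l2_unit n)) m * v n)\<^sup>2) \<le> (\<Sum>n<k. (v n)\<^sup>2)"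
    by (simp add: L2_set_def)
qed

text \<open>
  Only the values on \<open>l2_fin k\<close> matter; the truncation makes the map total with range in
  \<open>l2_fin k\<close>.
\<close>

definition matrix_map :: "nat \<Rightarrow> (nat \<Rightarrow> nat \<Rightarrow> real) \<Rightarrow> real l2 \<Rightarrow> real l2"
  where "matrix_map k a \<xi> = Abs_l2 (\<lambda>m. if m < k then \<Sum>n<k. a m n * l2_nth \<xi> n else 0)"

lemma l2_nth_matrix_map:
  "l2_nth (matrix_map k a \<xi>) m = (if m < k then \<Sum>n<k. a m n * l2_nth \<xi> n else 0)"
  unfolding matrix_map_def by (subst l2_nth_Abs_l2_fin[of k]) auto

lemma l2_nth_matrix_map_unit:
  "n < k \<Longrightarrow> l2_nth (matrix_map k a (l2_unit n)) m = (if m < k then a m n else 0)"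
  by (simp add: l2_nth_matrix_map l2_unit.rep_eq if_distrib cong: if_cong)

lemma matrix_map_in_l2_fin: "matrix_map k a \<xi> \<in> l2_fin k"
  by (simp add: l2_fin_def l2_nth_matrix_map)

lemma linear_between_matrix_map: "linear_between (l2_fin k) (l2_fin k) (matrix_map k a)"
  using matrix_map_in_l2_fin
  by (auto simp: linear_between_def l2_nth_inject[symmetric] fun_eq_iff l2_nth_matrix_map
      plus_l2.rep_eq scaleR_l2.rep_eq algebra_simps sum.distrib sum_distrib_left)

lemma onorm_on_matrix_map_le:
  assumes a: "contraction_mat {..<k} {..<k} a"
  shows "onorm_on (l2_fin k) (matrix_map k a) \<le> 1"
proof -
  have "norm (matrix_map k a \<xi>) \<le> 1 * norm \<xi>" if "\<xi> \<in> l2_fin k" for \<xi>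
    using contraction_matD[OF a, of "l2_nth \<xi>"]
    by (simp add: norm_l2_fin[OF that] norm_l2_fin[OF matrix_map_in_l2_fin] l2_nth_matrix_map L2_set_def)
  from onorm_on_le[OF this] show ?thesis by simp
qed

lemma suminf_l2_fin:
  fixes x :: "'a::banach l2"
  assumes "x \<in> l2_fin k"
  shows "(\<Sum>n. c n *\<^sub>R l2_nth x n) = (\<Sum>n<k. c n *\<^sub>R l2_nth x n)"
  by (rule suminf_finite) (use assms in \<open>auto simp: l2_fin_def\<close>)

lemma contraction_amplification_le:
  fixes x :: "nat \<Rightarrow> 'a::banach"
  assumes c: "\<And>a. linear_between (l2_fin k) (l2_fin k) a \<Longrightarrow> onorm_on (l2_fin k) a \<le> 1 \<Longrightarrow>
      onorm_on (l2_fin k) (tensor_Id a :: 'a l2 \<Rightarrow> 'a l2) \<le> ennreal c" "0 \<le> c"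
    and a: "contraction_mat {..<k} {..<k} a"
  shows "L2_set (\<lambda>m. norm (\<Sum>n<k. a m n *\<^sub>R x n)) {..<k} \<le> c * L2_set (\<lambda>n. norm (x n)) {..<k}"
proof -
  define X where "X = Abs_l2 (\<lambda>n. if n < k then x n else 0)"
  have X_nth: "l2_nth X n = (if n < k then x n else 0)" for n
    unfolding X_def by (subst l2_nth_Abs_l2_fin[of k]) auto
  then have X: "X \<in> l2_fin k" by (simp add: l2_fin_def)
  define Y where "Y = tensor_Id (matrix_map k a) X"
  have "(\<Sum>n. l2_nth (matrix_map k a (l2_unit n)) m *\<^sub>R l2_nth X n)
      = (if m < k then \<Sum>n<k. a m n *\<^sub>R x n else 0)" for m
    unfolding suminf_l2_fin[OF X] by (simp add: l2_nth_matrix_map_unit X_nth)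
  then have Y_nth: "l2_nth Y m = (if m < k then \<Sum>n<k. a m n *\<^sub>R x n else 0)" for m
    unfolding Y_def tensor_Id_def by (simp add: l2_nth_Abs_l2_fin[of k])
  then have Y: "Y \<in> l2_fin k" by (simp add: l2_fin_def)
  have "norm Y \<le> c * norm X"
    unfolding Y_def
  proof (rule norm_le_of_onorm_on[OF c(1) X c(2)])
    show "linear_between (l2_fin k) (l2_fin k) (matrix_map k a)" by (rule linear_between_matrix_map)
    show "onorm_on (l2_fin k) (matrix_map k a) \<le> 1" by (rule onorm_on_matrix_map_le[OF a])
    assume "X = 0"
    then have "l2_nth X n = 0" for n by (simp add: zero_l2.rep_eq)
    then show "tensor_Id (matrix_map k a) X = 0" by (simp add: tensor_Id_def zero_l2_def)
  qed
  then show ?thesis by (simp add: norm_l2_fin[OF X] norm_l2_fin[OF Y] X_nth Y_nth L2_set_def)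
qed

lemma contraction_mat_of_bounded_linear:
  assumes u: "bounded_linear u" "onorm u \<le> 1"
  shows "contraction_mat {..<M} {..<N} (\<lambda>m n. l2_nth (u (l2_unit n)) m)"
  unfolding contraction_mat_def
proof
  fix v :: "nat \<Rightarrow> real"
  interpret bounded_linear u by fact
  define \<xi> :: "real l2" where "\<xi> = (\<Sum>n<N. v n *\<^sub>R l2_unit n)"
  have \<xi>: "\<xi> \<in> l2_fin N"
    unfolding \<xi>_def
    by (intro subspace_sum subspace_l2_fin subspace_scale l2_unit_in_l2_fin) auto
  have "norm \<xi> = L2_set v {..<N}"
    unfolding norm_l2_fin[OF \<xi>] by (simp add: \<xi>_def l2_nth_sum_units L2_set_def)
  have u\<xi>: "l2_nth (u \<xi>) m = (\<Sum>n<N. l2_nth (u (l2_unit n)) m * v n)" for m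
    by (simp add: \<xi>_def sum scale l2_nth_sum scaleR_l2.rep_eq mult.commute)
  have "L2_set (\<lambda>m. norm (l2_nth (u \<xi>) m)) {..<M} \<le> norm (u \<xi>)" by (rule L2_set_l2_nth_le)
  also have "\<dots> \<le> onorm u * norm \<xi>" by (rule onorm[OF u(1)])
  also have "\<dots> \<le> L2_set v {..<N}"
    using mult_right_mono[OF u(2), of "norm \<xi>"] \<open>norm \<xi> = _\<close> by simp
  finally show "(\<Sum>m<M. (\<Sum>n<N. l2_nth (u (l2_unit n)) m * v n)\<^sup>2) \<le> (\<Sum>n<N. (v n)\<^sup>2)"
    by (simp add: L2_set_def u\<xi>)
qed

text \<open>
  A row of the matrix of a contraction is a square-summable sequence of norm at most \<open>1\<close>, so the series
  converges absolutely by Cauchy-Schwarz. The bound on the row comes from applying the transpose of a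
  finite section to a unit vector.
\<close>

lemma summable_tensor_Id:
  fixes x :: "'a::banach l2"
  assumes u: "bounded_linear u" "onorm u \<le> 1"
  shows "summable (\<lambda>n. l2_nth (u (l2_unit n)) m *\<^sub>R l2_nth x n)"
proof (rule summable_norm_cancel, rule summableI_nonneg_bounded)
  fix N
  define U where "U n = l2_nth (u (l2_unit n)) m" for n
  have "(\<Sum>n<N. (\<Sum>i<Suc m. l2_nth (u (l2_unit n)) i * (if i = m then 1 else 0))\<^sup>2)
      \<le> (\<Sum>i<Suc m. (if i = m then 1 else 0)\<^sup>2)"
    by (rule contraction_matD[OF contraction_mat_transpose[OF contraction_mat_of_bounded_linear[OF u]]])
  then have "L2_set U {..<N} \<le> 1"
    by (simp add: L2_set_def U_def if_distrib cong: if_cong)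
  have "(\<Sum>n<N. norm (U n *\<^sub>R l2_nth x n)) = (\<Sum>n<N. \<bar>U n\<bar> * \<bar>norm (l2_nth x n)\<bar>)" by simp
  also have "\<dots> \<le> L2_set U {..<N} * L2_set (\<lambda>n. norm (l2_nth x n)) {..<N}" by (rule L2_set_mult_ineq)
  also have "\<dots> \<le> 1 * norm x"
    by (intro mult_mono \<open>L2_set U {..<N} \<le> 1\<close> L2_set_l2_nth_le) auto
  finally show "(\<Sum>n<N. norm (l2_nth (u (l2_unit n)) m *\<^sub>R l2_nth x n)) \<le> norm x"
    by (simp add: U_def)
qed auto

text \<open>
  A finite section of the matrix of \<open>u\<close> is again a contraction of rank at most \<open>k\<close>: its columns are the
  truncations of vectors in the \<open>k\<close>-dimensional range of \<open>u\<close>. The bound for finite sections does not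
  depend on their size and survives the two limits, first in the columns, then in the rows.
\<close>

lemma e_const_le:
  assumes c: "\<And>a. linear_between (l2_fin k) (l2_fin k) a \<Longrightarrow> onorm_on (l2_fin k) a \<le> 1 \<Longrightarrow>
      onorm_on (l2_fin k) (tensor_Id a :: 'a l2 \<Rightarrow> 'a l2) \<le> ennreal c" "0 \<le> c"
  shows "e_const TYPE('a::banach) k \<le> ennreal (2 * c)"
  unfolding e_const_def
proof (rule SUP_least)
  fix u :: "real l2 \<Rightarrow> real l2"
  assume "u \<in> {u. bounded_linear u \<and> onorm u = 1 \<and> finite_dim (range u) \<and> dim (range u) = k}"
  then have u: "bounded_linear u" "onorm u \<le> 1" and "finite_dim (range u)" "dim (range u) = k"
    by auto
  then obtain B\<^sub>0 where "finite B\<^sub>0" "range u \<subseteq> span B\<^sub>0" by (auto simp: finite_dim_def)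
  obtain B where B: "B \<subseteq> range u" "independent B" "range u \<subseteq> span B" "card B = k"
    using real_vector.basis_exists[of "range u"] \<open>dim (range u) = k\<close> by metis
  have "finite B"
    using real_vector.independent_span_bound[OF \<open>finite B\<^sub>0\<close> B(2)] B(1) \<open>range u \<subseteq> span B\<^sub>0\<close> by blast
  have "\<exists>w. u (l2_unit n) = (\<Sum>\<beta>\<in>B. w \<beta> *\<^sub>R \<beta>)" for n
    using B(3) real_vector.span_finite[OF \<open>finite B\<close>] by blast
  then obtain w where w: "\<And>n. u (l2_unit n) = (\<Sum>\<beta>\<in>B. w n \<beta> *\<^sub>R \<beta>)" by metis
  have factor: "l2_nth (u (l2_unit n)) m = (\<Sum>\<beta>\<in>B. l2_nth \<beta> m * w n \<beta>)" for m n
    by (simp add: w l2_nth_sum scaleR_l2.rep_eq mult.commute)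
  show "onorm_on UNIV (tensor_Id u :: 'a l2 \<Rightarrow> 'a l2) \<le> ennreal (2 * c)"
  proof (rule onorm_on_le)
    fix x :: "'a l2"
    show "norm (tensor_Id u x) \<le> 2 * c * norm x"
    proof (rule norm_tensor_Id_le)
      fix M
      define S where "S N m = (\<Sum>n<N. l2_nth (u (l2_unit n)) m *\<^sub>R l2_nth x n)" for N m
      have "L2_set (\<lambda>m. norm (S N m)) {..<M} \<le> 2 * c * norm x" for N
      proof -
        have "L2_set (\<lambda>m. norm (S N m)) {..<M} \<le> 2 * c * L2_set (\<lambda>n. norm (l2_nth x n)) {..<N}"
          unfolding S_def
          by (rule rank_amplification_le[OF contraction_amplification_le[OF c] c(2) _ _ \<open>finite B\<close>])
             (use B(4) contraction_mat_of_bounded_linear[OF u] factor in auto)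
        also have "\<dots> \<le> 2 * c * norm x"
          using c(2) by (intro mult_left_mono L2_set_l2_nth_le) auto
        finally show ?thesis .
      qed
      moreover have "(\<lambda>N. L2_set (\<lambda>m. norm (S N m)) {..<M}) \<longlonglongrightarrow>
          L2_set (\<lambda>m. norm (\<Sum>n. l2_nth (u (l2_unit n)) m *\<^sub>R l2_nth x n)) {..<M}"
        unfolding L2_set_def S_def
        by (intro tendsto_intros summable_LIMSEQ summable_tensor_Id u)
      ultimately show "L2_set (\<lambda>m. norm (\<Sum>n. l2_nth (u (l2_unit n)) m *\<^sub>R l2_nth x n)) {..<M}
          \<le> 2 * c * norm x"
        by (intro LIMSEQ_le_const2) auto
    qed
  qed (use c(2) in simp)
qed


section \<open>Comparison with Hilbert spaces\<close>

text \<open>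
  On Hilbert-space-valued sequences a scalar matrix acts coordinatewise, so a contraction stays one.
\<close>

lemma hilbert_amplification_le:
  fixes \<xi> :: "'j \<Rightarrow> real l2"
  assumes a: "contraction_mat I J a" and \<xi>: "\<And>j. j \<in> J \<Longrightarrow> \<xi> j \<in> l2_fin d"
  shows "L2_set (\<lambda>i. norm (\<Sum>j\<in>J. a i j *\<^sub>R \<xi> j)) I \<le> L2_set (\<lambda>j. norm (\<xi> j)) J"
proof -
  have sq: "(norm x)\<^sup>2 = (\<Sum>l<d. (l2_nth x l)\<^sup>2)" if "x \<in> l2_fin d" for x :: "real l2"
    by (simp add: norm_l2_fin[OF that] L2_set_def sum_nonneg)
  have in_fin: "(\<Sum>j\<in>J. a i j *\<^sub>R \<xi> j) \<in> l2_fin d" for i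
    by (intro subspace_sum subspace_l2_fin subspace_scale \<xi>)
  have "(\<Sum>i\<in>I. (norm (\<Sum>j\<in>J. a i j *\<^sub>R \<xi> j))\<^sup>2)
      = (\<Sum>l<d. \<Sum>i\<in>I. (\<Sum>j\<in>J. a i j * l2_nth (\<xi> j) l)\<^sup>2)"
    by (simp add: sq[OF in_fin] l2_nth_sum scaleR_l2.rep_eq) (rule sum.swap)
  also have "\<dots> \<le> (\<Sum>l<d. \<Sum>j\<in>J. (l2_nth (\<xi> j) l)\<^sup>2)"
    by (intro sum_mono contraction_matD a)
  also have "\<dots> = (\<Sum>j\<in>J. (norm (\<xi> j))\<^sup>2)"
    by (subst sum.swap) (simp add: sq \<xi>)
  finally show ?thesis unfolding L2_set_def by (rule real_sqrt_le_mono)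
qed

text \<open>
  An isomorphism \<open>u\<close> of \<open>E\<close> onto a Hilbert space conjugates the action of \<open>a\<close> on \<open>E\<close>-valued sequences to
  its action on Hilbert-space-valued ones, at the cost of \<open>\<parallel>u\<parallel> \<parallel>u\<^sup>-\<^sup>1\<parallel>\<close>.
\<close>

lemma amplification_le_banach_mazur_dist:
  fixes x :: "'j \<Rightarrow> 'a::real_normed_vector"
  assumes a: "contraction_mat I J a" and E: "subspace E" and x: "\<And>j. j \<in> J \<Longrightarrow> x j \<in> E"
    and nz: "j\<^sub>0 \<in> J" "x j\<^sub>0 \<noteq> 0" and J: "finite J"
  shows "ennreal (L2_set (\<lambda>i. norm (\<Sum>j\<in>J. a i j *\<^sub>R x j)) I / L2_set (\<lambda>j. norm (x j)) J)
    \<le> banach_mazur_dist E (l2_fin d :: real l2 set)"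
  unfolding banach_mazur_dist_def
proof (rule INF_greatest)
  fix u :: "'a \<Rightarrow> real l2"
  assume "u \<in> {u. linear_between E (l2_fin d) u \<and> bij_betw u E (l2_fin d)}"
  then have u: "linear_between E (l2_fin d) u" and bij: "bij_betw u E (l2_fin d)" by auto
  define v where "v = inv_into E u"
  have v: "v (u z) = z" if "z \<in> E" for z
    using bij that by (simp add: v_def bij_betw_def)
  have u_in: "u z \<in> l2_fin d" if "z \<in> E" for z using bij that by (auto simp: bij_betw_def)
  have u0: "u 0 = 0" by (rule linear_between_0[OF u subspace_0[OF E]])
  have v0: "v 0 = 0" using v[OF subspace_0[OF E]] by (simp add: u0)
  have "x j\<^sub>0 \<in> E" using x nz by simp
  have "u (x j\<^sub>0) \<noteq> 0" using v[OF \<open>x j\<^sub>0 \<in> E\<close>] v0 nz by auto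
  (* In the extended nonnegative reals 0 times infinity is 0; the nonzero vector of E excludes this
     product. *)
  have pos: "0 < onorm_on E u" "0 < onorm_on (l2_fin d) v"
  proof -
    have "0 < ennreal (norm (u (x j\<^sub>0)) / norm (x j\<^sub>0))"
      using \<open>u (x j\<^sub>0) \<noteq> 0\<close> nz by simp
    also have "\<dots> \<le> onorm_on E u" unfolding onorm_on_def by (rule SUP_upper[OF \<open>x j\<^sub>0 \<in> E\<close>])
    finally show "0 < onorm_on E u" .
    have "0 < ennreal (norm (v (u (x j\<^sub>0))) / norm (u (x j\<^sub>0)))"
      using \<open>u (x j\<^sub>0) \<noteq> 0\<close> nz v[OF \<open>x j\<^sub>0 \<in> E\<close>] by simp
    also have "\<dots> \<le> onorm_on (l2_fin d) v"
      unfolding onorm_on_def by (rule SUP_upper[OF u_in[OF \<open>x j\<^sub>0 \<in> E\<close>]])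
    finally show "0 < onorm_on (l2_fin d) v" .
  qed
  show "ennreal (L2_set (\<lambda>i. norm (\<Sum>j\<in>J. a i j *\<^sub>R x j)) I / L2_set (\<lambda>j. norm (x j)) J)
    \<le> onorm_on E u * onorm_on (l2_fin d) (inv_into E u)"
  proof (cases "onorm_on E u = top \<or> onorm_on (l2_fin d) v = top")
    case True
    then have "onorm_on E u * onorm_on (l2_fin d) v = top"
      using pos by (auto simp: ennreal_mult_eq_top_iff)
    then show ?thesis by (simp add: v_def)
  next
    case False
    then obtain p q where p: "onorm_on E u = ennreal p" "0 \<le> p"
      and q: "onorm_on (l2_fin d) v = ennreal q" "0 \<le> q"
      by (metis ennreal_cases)
    have u_le: "norm (u z) \<le> p * norm z" if "z \<in> E" for z
      by (rule norm_le_of_onorm_on[OF _ that p(2)]) (use p u0 in auto)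
    have v_le: "norm (v \<xi>) \<le> q * norm \<xi>" if "\<xi> \<in> l2_fin d" for \<xi>
      by (rule norm_le_of_onorm_on[OF _ that q(2)]) (use q v0 in auto)
    have "norm (\<Sum>j\<in>J. a i j *\<^sub>R x j) \<le> q * norm (\<Sum>j\<in>J. a i j *\<^sub>R u (x j))" for i
    proof -
      have s: "(\<Sum>j\<in>J. a i j *\<^sub>R x j) \<in> E" by (intro subspace_sum E subspace_scale x)
      have "norm (\<Sum>j\<in>J. a i j *\<^sub>R x j) \<le> q * norm (u (\<Sum>j\<in>J. a i j *\<^sub>R x j))"
        using v_le[OF u_in[OF s]] v[OF s] by simp
      also have "u (\<Sum>j\<in>J. a i j *\<^sub>R x j) = (\<Sum>j\<in>J. a i j *\<^sub>R u (x j))"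
        by (rule linear_between_sum[OF E u x])
      finally show ?thesis .
    qed
    then have "L2_set (\<lambda>i. norm (\<Sum>j\<in>J. a i j *\<^sub>R x j)) I
        \<le> L2_set (\<lambda>i. q * norm (\<Sum>j\<in>J. a i j *\<^sub>R u (x j))) I"
      by (intro L2_set_mono) auto
    also have "\<dots> = q * L2_set (\<lambda>i. norm (\<Sum>j\<in>J. a i j *\<^sub>R u (x j))) I"
      by (rule L2_set_right_distrib[OF q(2), symmetric])
    also have "\<dots> \<le> q * L2_set (\<lambda>j. norm (u (x j))) J"
      by (intro mult_left_mono hilbert_amplification_le[OF a, of _ d] u_in x q)
    also have "\<dots> \<le> q * L2_set (\<lambda>j. p * norm (x j)) J"
      by (intro mult_left_mono L2_set_mono u_le x q) auto
    also have "\<dots> = p * q * L2_set (\<lambda>j. norm (x j)) J"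
      by (simp add: L2_set_right_distrib[OF p(2), symmetric])
    finally have "L2_set (\<lambda>i. norm (\<Sum>j\<in>J. a i j *\<^sub>R x j)) I \<le> p * q * L2_set (\<lambda>j. norm (x j)) J" .
    moreover have "0 < L2_set (\<lambda>j. norm (x j)) J"
      using nz(2) zero_less_norm_iff[of "x j\<^sub>0"] member_le_L2_set[OF J nz(1), of "\<lambda>j. norm (x j)"]
      by linarith
    ultimately have "L2_set (\<lambda>i. norm (\<Sum>j\<in>J. a i j *\<^sub>R x j)) I / L2_set (\<lambda>j. norm (x j)) J \<le> p * q"
      by (simp add: divide_le_eq)
    then show ?thesis
      by (simp add: v_def[symmetric] p q ennreal_mult[symmetric] ennreal_leI)
  qed
qed

text \<open>
  A sequence of length \<open>k\<close> spans a subspace of dimension at most \<open>k\<close>, and the comparison with a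
  Hilbert space takes place in this subspace.
\<close>

lemma onorm_on_tensor_Id_le_d_const:
  assumes a: "linear_between (l2_fin k) (l2_fin k) a" "onorm_on (l2_fin k) a \<le> 1"
  shows "onorm_on (l2_fin k) (tensor_Id a :: 'a::banach l2 \<Rightarrow> 'a l2) \<le> d_const TYPE('a) k"
  unfolding onorm_on_def
proof (rule SUP_least)
  fix x :: "'a l2" assume x: "x \<in> l2_fin k"
  show "ennreal (norm (tensor_Id a x) / norm x) \<le> d_const TYPE('a) k"
  proof (cases "x = 0")
    case False
    have "\<exists>n<k. l2_nth x n \<noteq> 0"
    proof (rule ccontr)
      assume "\<not> ?thesis"
      then have "l2_nth x n = l2_nth 0 n" for n
        using x by (cases "n < k") (auto simp: l2_fin_def zero_l2.rep_eq)
      then have "x = 0" by (simp add: l2_nth_inject[symmetric] fun_eq_iff)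
      with False show False by simp
    qed
    then obtain n\<^sub>0 where n\<^sub>0: "n\<^sub>0 \<in> {..<k}" "l2_nth x n\<^sub>0 \<noteq> 0" by auto
    define E where "E = span (l2_nth x ` {..<k})"
    have "card (l2_nth x ` {..<k}) \<le> k" using card_image_le[of "{..<k}" "l2_nth x"] by simp
    then have "dim E \<le> k"
      using real_vector.dim_le_card[of E "l2_nth x ` {..<k}"] by (simp add: E_def)
    moreover have "finite_dim E" by (auto simp: finite_dim_def E_def intro!: exI[of _ "l2_nth x ` {..<k}"])
    moreover have "subspace E" by (simp add: E_def)
    ultimately have le_d: "banach_mazur_dist E (l2_fin (dim E) :: real l2 set) \<le> d_const TYPE('a) k"
      unfolding d_const_def by (intro SUP_upper) auto
    define A where "A m n = l2_nth (a (l2_unit n)) m" for m n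
    have A: "contraction_mat {..<k} {..<k} A"
      unfolding A_def by (rule contraction_mat_of_linear_between[OF a])
    have "l2_nth (a (l2_unit n)) m = 0" if "n < k" "k \<le> m" for m n
      using a(1) l2_unit_in_l2_fin[OF that(1)] that(2) by (auto simp: linear_between_def l2_fin_def)
    then have zero: "(\<Sum>n. l2_nth (a (l2_unit n)) m *\<^sub>R l2_nth x n) = 0" if "k \<le> m" for m
      using that by (simp add: suminf_l2_fin[OF x])
    then have nth: "l2_nth (tensor_Id a x) m = (\<Sum>n<k. A m n *\<^sub>R l2_nth x n)" for m
      unfolding tensor_Id_def by (subst l2_nth_Abs_l2_fin[of k]) (auto simp: A_def suminf_l2_fin[OF x])
    then have "tensor_Id a x \<in> l2_fin k"
      using zero by (simp add: l2_fin_def A_def suminf_l2_fin[OF x])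
    then have "ennreal (norm (tensor_Id a x) / norm x)
        = ennreal (L2_set (\<lambda>m. norm (\<Sum>n<k. A m n *\<^sub>R l2_nth x n)) {..<k}
            / L2_set (\<lambda>n. norm (l2_nth x n)) {..<k})"
      by (simp add: norm_l2_fin x nth)
    also have "\<dots> \<le> banach_mazur_dist E (l2_fin (dim E) :: real l2 set)"
      by (rule amplification_le_banach_mazur_dist[where x = "l2_nth x", OF A \<open>subspace E\<close> _ n\<^sub>0])
         (auto simp: E_def intro: span_base)
    also note le_d
    finally show ?thesis .
  qed simp
qed

theorem theorem5p2:
  fixes k :: nat
  assumes "k \<ge> 1"
  shows "e_const TYPE('a::banach) k \<le>
           2 * (SUP a\<in>{a. linear_between (l2_fin k) (l2_fin k) a \<and> onorm_on (l2_fin k) a \<le> 1}.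
                  onorm_on (l2_fin k) (tensor_Id a :: 'a l2 \<Rightarrow> 'a l2))
         \<and> e_const TYPE('a) k \<le> 2 * d_const TYPE('a) k"
proof -
  define C where "C = (SUP a\<in>{a. linear_between (l2_fin k) (l2_fin k) a \<and> onorm_on (l2_fin k) a \<le> 1}.
    onorm_on (l2_fin k) (tensor_Id a :: 'a l2 \<Rightarrow> 'a l2))"
  have upper: "onorm_on (l2_fin k) (tensor_Id a :: 'a l2 \<Rightarrow> 'a l2) \<le> C"
    if "linear_between (l2_fin k) (l2_fin k) a" "onorm_on (l2_fin k) a \<le> 1" for a
    unfolding C_def by (rule SUP_upper) (use that in simp)
  have e_le: "e_const TYPE('a) k \<le> 2 * C"
  proof (cases C)
    case (real c)
    then have "e_const TYPE('a) k \<le> ennreal (2 * c)"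
      using upper by (intro e_const_le) auto
    with real show ?thesis by (simp add: ennreal_mult)
  next
    case top
    then show ?thesis by (simp add: ennreal_mult_top)
  qed
  have "C \<le> d_const TYPE('a) k"
    unfolding C_def by (rule SUP_least) (auto intro: onorm_on_tensor_Id_le_d_const)
  with e_le have "e_const TYPE('a) k \<le> 2 * d_const TYPE('a) k"
    by (meson mult_left_mono order_trans zero_le)
  with e_le show ?thesis unfolding C_def by blast
qed

end
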